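(* Let $u\in X=H^1_D(\Omega)\cap[u_-,u_+]$. Then $u$ is a solution of the weak form of the Hamiltonian constraint (Lichnerowicz equation), i.e. $$\int_{\Omega}\Big[(\bar a\,\nabla u)\cdot\nabla v+\Big(\tfrac{R}{8}u+\tfrac{\tau^2}{12}u^5-\tfrac{\sigma^2}{8}u^{-7}-2\pi\rho\,u^{-3}\Big)v\Big]\,dx+\int_{\partial_N\Omega}(cu-g_N)\,v\,ds=0\qquad\text{for all } v\in H^1_0(\Omega),$$ if and only if $u$ is a critical point of the energy functional $$J(u)=\int_{\Omega}\Big[\tfrac12(\bar a\,\nabla u)\cdot\nabla u+\tfrac1{16}Ru^2+\tfrac1{72}\tau^2u^6+\tfrac1{48}\sigma^2u^{-6}+\pi\rho\,u^{-2}\Big]\,dx+\tfrac12\int_{\partial_N\Omega}cu^2\,ds-\int_{\partial_N\Omega}g_N\,u\,ds .$$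
   Context: $\Omega\subset\mathbb{R}^3$ is the spatial domain, with boundary $\partial\Omega=\partial_D\Omega\cup\partial_N\Omega$, $\partial_D\Omega\cap\partial_N\Omega=\emptyset$. The equation in strong form is $-\nabla\cdot(\bar a\nabla u)+\frac R8u=-\frac{\tau^2}{12}u^5+\frac{\sigma^2}{8}u^{-7}+2\pi\rho u^{-3}$ in $\Omega$, with $(\bar a\nabla u)\cdot n+cu=g_N$ on $\partial_N\Omega$ ($n$ the unit normal) and $u=g_D$ on $\partial_D\Omega$. Here $\bar a$ and $c$ are given coefficients, $g_N$ and $g_D$ are given boundary data, and $R,\tau^2,\sigma^2$ are real-valued functions on $\Omega$; $\rho,\sigma^2,\tau^2\ge0$ on $\Omega$, and there are positive constants $C_1,C_2$ with $-C_1\le R(x)\le C_2$. ($\tau$ may be considered to be constant, the constant mean curvature case; reasonable values of $\sigma$ satisfy $0\le\sigma^2\le C_3$ for a constant $C_3$.) Function spaces: $H^1_D(\Omega)=\{u\in H^1(\Omega): u=g_D\text{ on }\partial_D\Omega\}$ and $H^1_0(\Omega)=\{v\in H^1(\Omega): v=0\text{ on }\partial_D\Omega\}$ (test functions vanish only on $\partial_D\Omega$). The set $[u_-,u_+]$ denotes functions taking values pointwise between $u_-$ and $u_+$, an interval that is strictly positive or strictly negative, so that the negative powers of $u$ do not blow up. Critical point means that the Gateaux derivative of $J$ at $u$, computed formally as $\frac{d}{dt}J(u+tv)\big|_{t=0}$, vanishes for all $v\in H^1_0(\Omega)$.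
   Formalization: The coefficient ā is assumed symmetric (the claim fails otherwise) and bounded; c is bounded, g_N, τ², σ², ρ are square integrable so that the integrals exist, and Ω is assumed to admit traces with smooth functions dense in H¹(Ω). *)

theory Defs
  imports "HOL-Analysis.Analysis"
begin

section \<open>Surface measure: the two-dimensional Hausdorff measure on three-space\<close>

definition hausdorff2_pre :: "real \<Rightarrow> (real^3) set \<Rightarrow> ennreal" where
  "hausdorff2_pre \<delta> A =
     (INF C \<in> {C :: nat \<Rightarrow> (real^3) set. A \<subseteq> (\<Union>i. C i) \<and> (\<forall>i. bounded (C i) \<and> diameter (C i) \<le> \<delta>)}.
        \<Sum>i. ennreal (pi / 4 * (diameter (C i))\<^sup>2))"

definition hausdorff2 :: "(real^3) set \<Rightarrow> ennreal" where
  "hausdorff2 A = (SUP \<delta>\<in>{0<..}. hausdorff2_pre \<delta> A)"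

definition surface_measure :: "(real^3) measure" where
  "surface_measure = measure_of UNIV (sets borel) hausdorff2"

text \<open>\<^const>\<open>measure_of\<close> silently yields the null measure unless its argument is countably
  additive, so we verify Caratheodory's criterion; the result is \<open>emeasure_surface_measure\<close>.\<close>

lemma hausdorff2_pre_mono: "A \<subseteq> B \<Longrightarrow> hausdorff2_pre \<delta> A \<le> hausdorff2_pre \<delta> B"
  unfolding hausdorff2_pre_def by (rule INF_superset_mono) auto

lemma hausdorff2_pre_antimono: "\<delta> \<le> \<epsilon> \<Longrightarrow> hausdorff2_pre \<epsilon> A \<le> hausdorff2_pre \<delta> A"
  unfolding hausdorff2_pre_def by (rule INF_superset_mono) (auto intro: order_trans)

lemma hausdorff2_mono: "A \<subseteq> B \<Longrightarrow> hausdorff2 A \<le> hausdorff2 B"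
  unfolding hausdorff2_def by (rule SUP_mono) (auto intro: hausdorff2_pre_mono)

lemma hausdorff2_pre_le: "0 < \<delta> \<Longrightarrow> hausdorff2_pre \<delta> A \<le> hausdorff2 A"
  unfolding hausdorff2_def by (rule SUP_upper) auto

lemma hausdorff2_empty [simp]: "hausdorff2 {} = 0"
proof -
  have "hausdorff2_pre \<delta> {} \<le> 0" if "0 < \<delta>" for \<delta>
    unfolding hausdorff2_pre_def
    by (rule INF_lower2[where i="\<lambda>_. {}"]) (use that in auto)
  then show ?thesis
    unfolding hausdorff2_def by (auto intro!: antisym SUP_least)
qed

lemma hausdorff2_pre_subadditive:
  "hausdorff2_pre \<delta> (\<Union>n. A n) \<le> (\<Sum>n. hausdorff2_pre \<delta> (A n))"
proof (rule ennreal_le_epsilon)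
  fix e :: real assume e: "0 < e" and fin: "(\<Sum>n. hausdorff2_pre \<delta> (A n)) < top"
  let ?w = "\<lambda>S :: (real^3) set. ennreal (pi / 4 * (diameter S)\<^sup>2)"
  have "\<exists>C. A n \<subseteq> (\<Union>i. C i) \<and> (\<forall>i. bounded (C i) \<and> diameter (C i) \<le> \<delta>) \<and>
      (\<Sum>i. ?w (C i)) \<le> hausdorff2_pre \<delta> (A n) + ennreal (e * (1/2) ^ Suc n)" for n
  proof -
    have "hausdorff2_pre \<delta> (A n) < top"
      using fin by (metis ennreal_suminf_neq_top ennreal_suminf_lessD less_top)
    then have "hausdorff2_pre \<delta> (A n) < hausdorff2_pre \<delta> (A n) + ennreal (e * (1/2) ^ Suc n)"
      using e ennreal_add_left_cancel_less[of "hausdorff2_pre \<delta> (A n)" 0] by auto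
    from this[unfolded hausdorff2_pre_def[of \<delta> "A n"] INF_less_iff] show ?thesis
      unfolding hausdorff2_pre_def[symmetric] by (auto intro: less_imp_le)
  qed
  then obtain C where C: "\<And>n. A n \<subseteq> (\<Union>i. C n i)"
      "\<And>n i. bounded (C n i)" "\<And>n i. diameter (C n i) \<le> \<delta>"
      "\<And>n. (\<Sum>i. ?w (C n i)) \<le> hausdorff2_pre \<delta> (A n) + ennreal (e * (1/2) ^ Suc n)"
    by metis
  let ?B = "\<lambda>k. case_prod C (prod_decode k)"
  have cov: "(\<Union>n. A n) \<subseteq> (\<Union>k. ?B k)"
  proof
    fix x assume "x \<in> (\<Union>n. A n)"
    then obtain n i where "x \<in> C n i" using C(1) by blast
    then show "x \<in> (\<Union>k. ?B k)" by (intro UN_I[of "prod_encode (n, i)"]) auto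
  qed
  have "hausdorff2_pre \<delta> (\<Union>n. A n) \<le> (\<Sum>k. ?w (?B k))"
    unfolding hausdorff2_pre_def
    by (rule INF_lower) (use cov C(2,3) in \<open>auto split: prod.split\<close>)
  also have "(\<Sum>k. ?w (?B k)) = (\<Sum>n. \<Sum>i. ?w (C n i))"
    by (rule suminf_ennreal_2dimen[where f="\<lambda>p. ?w (case_prod C p)"]) auto
  also have "\<dots> \<le> (\<Sum>n. hausdorff2_pre \<delta> (A n) + ennreal (e * (1/2) ^ Suc n))"
    by (intro suminf_le C(4)) auto
  also have "\<dots> = (\<Sum>n. hausdorff2_pre \<delta> (A n)) + (\<Sum>n. ennreal (e * (1/2) ^ Suc n))"
    by (intro suminf_add[symmetric]) auto
  also have "(\<Sum>n. ennreal (e * (1/2) ^ Suc n)) = ennreal e"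
  proof (rule suminf_ennreal_eq)
    show "(\<lambda>n. e * (1/2) ^ Suc n) sums e"
      using sums_mult[OF power_half_series, of e] by simp
  qed (use e in auto)
  finally show "hausdorff2_pre \<delta> (\<Union>n. A n) \<le> (\<Sum>n. hausdorff2_pre \<delta> (A n)) + ennreal e" .
qed

lemma hausdorff2_subadditive: "hausdorff2 (\<Union>n. A n) \<le> (\<Sum>n. hausdorff2 (A n))"
  unfolding hausdorff2_def[of "\<Union>n. A n"]
proof (rule SUP_least)
  fix \<delta> :: real assume "\<delta> \<in> {0<..}"
  then have "(\<Sum>n. hausdorff2_pre \<delta> (A n)) \<le> (\<Sum>n. hausdorff2 (A n))"
    by (intro suminf_le hausdorff2_pre_le) auto
  with hausdorff2_pre_subadditive show "hausdorff2_pre \<delta> (\<Union>n. A n) \<le> (\<Sum>n. hausdorff2 (A n))"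
    by (rule order_trans)
qed

lemma hausdorff2_Un_le: "hausdorff2 (A \<union> B) \<le> hausdorff2 A + hausdorff2 B"
proof -
  let ?S = "\<lambda>n::nat. if n = 0 then A else if n = 1 then B else {}"
  have "A \<union> B \<subseteq> (\<Union>n. ?S n)" by (auto intro: exI[of _ 0] exI[of _ 1])
  then have "hausdorff2 (A \<union> B) \<le> (\<Sum>n. hausdorff2 (?S n))"
    using hausdorff2_mono hausdorff2_subadditive order_trans by blast
  also have "\<dots> = (\<Sum>n\<in>{0,1}. hausdorff2 (?S n))"
    by (rule suminf_finite) auto
  finally show ?thesis by simp
qed

lemma hausdorff2_separated:
  assumes d: "0 < d" and sep: "\<And>x y. x \<in> A \<Longrightarrow> y \<in> B \<Longrightarrow> d \<le> dist x y"
  shows "hausdorff2 A + hausdorff2 B \<le> hausdorff2 (A \<union> B)"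
proof -
  let ?w = "\<lambda>S :: (real^3) set. ennreal (pi / 4 * (diameter S)\<^sup>2)"
  have pre: "hausdorff2_pre \<delta> A + hausdorff2_pre \<delta> B \<le> hausdorff2_pre \<delta> (A \<union> B)"
    if \<delta>: "0 < \<delta>" "\<delta> < d" for \<delta>
    unfolding hausdorff2_pre_def[of \<delta> "A \<union> B"]
  proof (rule INF_greatest)
    fix C :: "nat \<Rightarrow> (real^3) set"
    assume "C \<in> {C. A \<union> B \<subseteq> (\<Union>i. C i) \<and> (\<forall>i. bounded (C i) \<and> diameter (C i) \<le> \<delta>)}"
    then have C: "A \<union> B \<subseteq> (\<Union>i. C i)" "\<And>i. bounded (C i)" "\<And>i. diameter (C i) \<le> \<delta>" by auto
    define P where "P i = (if C i \<inter> A = {} then {} else C i)" for i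
    define Q where "Q i = (if C i \<inter> A = {} then C i else {})" for i
    have "x \<in> (\<Union>i. Q i)" if x: "x \<in> B" for x
    proof -
      obtain i where i: "x \<in> C i" using C(1) x by blast
      have "C i \<inter> A = {}"
      proof (rule ccontr)
        assume "C i \<inter> A \<noteq> {}"
        then obtain y where "y \<in> C i" "y \<in> A" by auto
        then have "d \<le> diameter (C i)"
          using diameter_bounded_bound[OF C(2), of y i x] sep[of y x] i x by auto
        then show False using C(3)[of i] \<delta> by auto
      qed
      then show ?thesis using i by (auto simp: Q_def)
    qed
    then have "hausdorff2_pre \<delta> B \<le> (\<Sum>i. ?w (Q i))"
      unfolding hausdorff2_pre_def using C \<delta>
      by (intro INF_lower) (auto simp: Q_def)
    moreover have "hausdorff2_pre \<delta> A \<le> (\<Sum>i. ?w (P i))"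
      unfolding hausdorff2_pre_def using C \<delta>
      by (intro INF_lower) (fastforce simp: P_def)+
    ultimately have "hausdorff2_pre \<delta> A + hausdorff2_pre \<delta> B \<le> (\<Sum>i. ?w (P i)) + (\<Sum>i. ?w (Q i))"
      by (rule add_mono[rotated])
    also have "\<dots> = (\<Sum>i. ?w (P i) + ?w (Q i))"
      by (rule suminf_add) auto
    also have "\<dots> = (\<Sum>i. ?w (C i))"
      by (rule suminf_cong) (auto simp: P_def Q_def)
    finally show "hausdorff2_pre \<delta> A + hausdorff2_pre \<delta> B \<le> (\<Sum>i. ?w (C i))" .
  qed
  have key: "hausdorff2_pre \<delta> A + hausdorff2_pre \<epsilon> B \<le> hausdorff2 (A \<union> B)"
    if "0 < \<delta>" "0 < \<epsilon>" for \<delta> \<epsilon>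
  proof -
    define m where "m = min (d / 2) (min \<delta> \<epsilon>)"
    have m: "0 < m" "m < d" "m \<le> \<delta>" "m \<le> \<epsilon>" using d that by (auto simp: m_def)
    have "hausdorff2_pre \<delta> A + hausdorff2_pre \<epsilon> B \<le> hausdorff2_pre m A + hausdorff2_pre m B"
      using m by (intro add_mono hausdorff2_pre_antimono) auto
    also have "\<dots> \<le> hausdorff2 (A \<union> B)"
      using pre[OF m(1,2)] hausdorff2_pre_le[OF m(1)] order_trans by blast
    finally show ?thesis .
  qed
  have "hausdorff2 A + hausdorff2_pre \<epsilon> B \<le> hausdorff2 (A \<union> B)" if "0 < \<epsilon>" for \<epsilon>
    unfolding hausdorff2_def[of A]
    by (subst ennreal_SUP_add_left[symmetric]) (auto intro!: SUP_least key that)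
  then have "hausdorff2 B + hausdorff2 A \<le> hausdorff2 (A \<union> B)"
    unfolding hausdorff2_def[of B]
    by (subst ennreal_SUP_add_left[symmetric]) (auto intro!: SUP_least simp: add.commute)
  then show ?thesis by (simp add: add.commute)
qed

lemma hausdorff2_closed_split:
  assumes F: "closed F" "F \<noteq> {}"
  shows "hausdorff2 (A \<inter> F) + hausdorff2 (A - F) \<le> hausdorff2 A"
proof (cases "hausdorff2 A = top")
  case False
  define G where "G n = {x \<in> A - F. 1 / real (Suc n) \<le> infdist x F}" for n
  define R where "R n = G (Suc n) - G n" for n
  have Gmono: "G m \<subseteq> G n" if "m \<le> n" for m n
  proof -
    have "1 / real (Suc n) \<le> 1 / real (Suc m)" using that by (simp add: frac_le)
    then show ?thesis by (auto simp: G_def)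
  qed
  have GA: "hausdorff2 (A \<inter> F) + hausdorff2 (G n) \<le> hausdorff2 A" for n
  proof -
    have "hausdorff2 (A \<inter> F) + hausdorff2 (G n) \<le> hausdorff2 ((A \<inter> F) \<union> G n)"
    proof (rule hausdorff2_separated)
      show "0 < 1 / real (Suc n)" by simp
      fix x y assume "x \<in> A \<inter> F" "y \<in> G n"
      then show "1 / real (Suc n) \<le> dist x y"
        using infdist_le[of x F y] by (auto simp: G_def dist_commute intro: order_trans)
    qed
    also have "\<dots> \<le> hausdorff2 A" by (rule hausdorff2_mono) (auto simp: G_def)
    finally show ?thesis .
  qed
  have cover: "A - F = G n \<union> (\<Union>k. R (k + n))" for n
  proof
    show "A - F \<subseteq> G n \<union> (\<Union>k. R (k + n))"
    proof
      fix x assume x: "x \<in> A - F"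
      then have "0 < infdist x F"
        using F in_closed_iff_infdist_zero[of F x] infdist_nonneg[of x F] by force
      then obtain m where "1 / real (Suc m) < infdist x F"
        using nat_approx_posE by blast
      then have ex: "\<exists>m. x \<in> G m" using x by (auto simp: G_def intro!: exI[of _ m])
      define m where "m = (LEAST m. x \<in> G m)"
      have xm: "x \<in> G m" unfolding m_def using ex by (rule LeastI_ex)
      show "x \<in> G n \<union> (\<Union>k. R (k + n))"
      proof (cases "m \<le> n")
        case True then show ?thesis using xm Gmono by blast
      next
        case False
        then obtain j where j: "m = Suc (j + n)"
          by (metis add.commute less_iff_Suc_add not_le)
        have "x \<notin> G (j + n)" using not_less_Least[of "j + n" "\<lambda>m. x \<in> G m"] j by (simp add: m_def)
        then have "x \<in> R (j + n)" using xm j by (simp add: R_def)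
        then show ?thesis by auto
      qed
    qed
  qed (auto simp: G_def R_def)
  have sepR: "1 / real (Suc (Suc i)) - 1 / real (j + 1) \<le> dist x y"
    if "x \<in> R i" "y \<in> R j" for i j x y
  proof -
    have "1 / real (Suc (Suc i)) \<le> infdist x F" using that by (auto simp: R_def G_def)
    moreover have "infdist y F \<le> 1 / real (Suc j)" using that by (auto simp: R_def G_def)
    moreover have "infdist x F \<le> infdist y F + dist x y" by (rule infdist_triangle)
    ultimately show ?thesis by (simp add: add.commute)
  qed
  have alt: "(\<Sum>k<n. hausdorff2 (R (2 * k + p))) \<le> hausdorff2 (\<Union>k<n. R (2 * k + p))" for n p
  proof (induction n)
    case (Suc n)
    have "hausdorff2 (\<Union>k<n. R (2 * k + p)) + hausdorff2 (R (2 * n + p))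
        \<le> hausdorff2 ((\<Union>k<n. R (2 * k + p)) \<union> R (2 * n + p))"
    proof (cases "n = 0")
      case False
      show ?thesis
      proof (rule hausdorff2_separated)
        show "0 < 1 / real (2 * n + p) - 1 / real (2 * n + p + 1)"
          using False by (simp add: frac_less2)
        fix x y assume "x \<in> (\<Union>k<n. R (2 * k + p))" and y: "y \<in> R (2 * n + p)"
        then obtain k where k: "k < n" "x \<in> R (2 * k + p)" by auto
        have "1 / real (2 * n + p) \<le> 1 / real (Suc (Suc (2 * k + p)))"
          using k by (intro divide_left_mono) auto
        with sepR[OF k(2) y]
        show "1 / real (2 * n + p) - 1 / real (2 * n + p + 1) \<le> dist x y" by linarith
      qed
    qed simp
    then have 1: "hausdorff2 (\<Union>k<n. R (2 * k + p)) + hausdorff2 (R (2 * n + p))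
        \<le> hausdorff2 (\<Union>k<Suc n. R (2 * k + p))"
      by (simp only: lessThan_Suc UN_insert Un_commute)
    have "(\<Sum>k<Suc n. hausdorff2 (R (2 * k + p)))
        = (\<Sum>k<n. hausdorff2 (R (2 * k + p))) + hausdorff2 (R (2 * n + p))"
      by simp
    also have "\<dots> \<le> hausdorff2 (\<Union>k<n. R (2 * k + p)) + hausdorff2 (R (2 * n + p))"
      by (rule add_right_mono) (rule Suc.IH)
    finally show ?case using 1 by (rule order_trans)
  qed simp
  have alt': "(\<Sum>k. hausdorff2 (R (2 * k + p))) \<le> hausdorff2 A" for p
    unfolding suminf_eq_SUP
  proof (rule SUP_least)
    fix n
    have "hausdorff2 (\<Union>k<n. R (2 * k + p)) \<le> hausdorff2 A"
      by (rule hausdorff2_mono) (auto simp: R_def G_def)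
    with alt show "(\<Sum>k<n. hausdorff2 (R (2 * k + p))) \<le> hausdorff2 A" by (rule order_trans)
  qed
  have fin: "(\<Sum>k. hausdorff2 (R k)) < top"
  proof -
    have "(\<Sum>k. hausdorff2 (R k)) \<le> hausdorff2 A + hausdorff2 A"
      unfolding suminf_eq_SUP
    proof (rule SUP_least)
      fix n
      have "(\<Sum>k<n. hausdorff2 (R k)) \<le> (\<Sum>k<2*n. hausdorff2 (R k))"
        by (rule sum_mono2) auto
      also have "\<dots> = (\<Sum>k<n. hausdorff2 (R (2 * k + 0))) + (\<Sum>k<n. hausdorff2 (R (2 * k + 1)))"
        by (induction n) (auto simp: algebra_simps)
      also have "\<dots> \<le> hausdorff2 A + hausdorff2 A"
        by (intro add_mono order_trans[OF _ alt'[of 0]] order_trans[OF _ alt'[of 1]] sum_le_suminf) auto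
      finally show "(\<Sum>k<n. hausdorff2 (R k)) \<le> hausdorff2 A + hausdorff2 A" .
    qed
    also have "\<dots> < top" using False by (simp add: less_top)
    finally show ?thesis .
  qed
  have tail: "(\<lambda>n. \<Sum>k. hausdorff2 (R (k + n))) \<longlonglongrightarrow> 0"
  proof -
    define r where "r k = enn2real (hausdorff2 (R k))" for k
    have r: "hausdorff2 (R k) = ennreal (r k)" "0 \<le> r k" for k
    proof -
      have "hausdorff2 (R k) < top" by (rule ennreal_suminf_lessD[OF fin])
      then show "hausdorff2 (R k) = ennreal (r k)" "0 \<le> r k" by (auto simp: r_def)
    qed
    have "summable r" using fin r by (intro summable_suminf_not_top) auto
    then have "(\<lambda>n. \<Sum>k. r (k + n)) \<longlonglongrightarrow> 0" by (rule suminf_exist_split2)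
    then have "(\<lambda>n. ennreal (\<Sum>k. r (k + n))) \<longlonglongrightarrow> ennreal 0" by (rule tendsto_ennrealI)
    moreover have "(\<Sum>k. hausdorff2 (R (k + n))) = ennreal (\<Sum>k. r (k + n))" for n
      unfolding r(1) by (rule suminf_ennreal2) (use \<open>summable r\<close> r in \<open>auto simp: summable_iff_shift\<close>)
    ultimately show ?thesis by simp
  qed
  have bound: "hausdorff2 (A \<inter> F) + hausdorff2 (A - F) \<le> hausdorff2 A + (\<Sum>k. hausdorff2 (R (k + n)))" for n
  proof -
    have "hausdorff2 (A - F) \<le> hausdorff2 (G n) + hausdorff2 (\<Union>k. R (k + n))"
      unfolding cover[of n] by (rule hausdorff2_Un_le)
    also have "\<dots> \<le> hausdorff2 (G n) + (\<Sum>k. hausdorff2 (R (k + n)))"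
      by (intro add_left_mono hausdorff2_subadditive)
    finally have "hausdorff2 (A \<inter> F) + hausdorff2 (A - F)
        \<le> (hausdorff2 (A \<inter> F) + hausdorff2 (G n)) + (\<Sum>k. hausdorff2 (R (k + n)))"
      by (simp add: add.assoc add_left_mono)
    also have "\<dots> \<le> hausdorff2 A + (\<Sum>k. hausdorff2 (R (k + n)))"
      by (intro add_right_mono GA)
    finally show ?thesis .
  qed
  have "(\<lambda>n. hausdorff2 A + (\<Sum>k. hausdorff2 (R (k + n)))) \<longlonglongrightarrow> hausdorff2 A + 0"
    by (intro tendsto_add tendsto_const tail)
  then show ?thesis
    using bound by (intro LIMSEQ_le_const[of _ "hausdorff2 A"]) auto
qed simp

lemma emeasure_surface_measure:
  "S \<in> sets borel \<Longrightarrow> emeasure surface_measure S = hausdorff2 S"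
proof -
  assume S: "S \<in> sets borel"
  let ?L = "lambda_system (UNIV :: (real^3) set) UNIV hausdorff2"
  interpret P: sigma_algebra "UNIV :: (real^3) set" UNIV
    using sigma_algebra_Pow[of UNIV] by simp
  have "outer_measure_space UNIV hausdorff2"
    by (auto simp: outer_measure_space_def positive_def increasing_def countably_subadditive_def
        intro: hausdorff2_mono hausdorff2_subadditive)
  then have L: "measure_space UNIV ?L hausdorff2" by (rule P.caratheodory_lemma)
  then interpret L: sigma_algebra UNIV ?L unfolding measure_space_def by (rule conjunct1)
  have "F \<in> ?L" if F: "closed F" for F
  proof (cases "F = {}")
    case False
    have "hausdorff2 (F \<inter> x) + hausdorff2 ((UNIV - F) \<inter> x) = hausdorff2 x" for x
    proof (rule antisym)
      have "F \<inter> x = x \<inter> F" "(UNIV - F) \<inter> x = x - F" by auto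
      then show "hausdorff2 (F \<inter> x) + hausdorff2 ((UNIV - F) \<inter> x) \<le> hausdorff2 x"
        using hausdorff2_closed_split[OF F False, of x] by simp
      have "(F \<inter> x) \<union> ((UNIV - F) \<inter> x) = x" by auto
      then show "hausdorff2 x \<le> hausdorff2 (F \<inter> x) + hausdorff2 ((UNIV - F) \<inter> x)"
        using hausdorff2_Un_le[of "F \<inter> x" "(UNIV - F) \<inter> x"] by simp
    qed
    then show ?thesis by (simp add: lambda_system_def)
  qed (use L.empty_sets in simp)
  then have "sets borel \<subseteq> ?L"
    unfolding borel_eq_closed by (auto intro!: L.sigma_sets_subset dest: subsetD)
  then have "measure_space UNIV (sets borel) hausdorff2"
    by (intro measure_down[OF L] ) (use sets.sigma_algebra_axioms[of "borel :: (real^3) measure"] in auto)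
  then have ca: "countably_additive (sets (borel :: (real^3) measure)) hausdorff2"
      "positive (sets (borel :: (real^3) measure)) hausdorff2"
    by (auto simp: measure_space_def)
  have sets_eq: "sets surface_measure = sets borel"
    unfolding surface_measure_def by (metis sets.sets_measure_of_eq space_borel)
  show ?thesis
    by (rule emeasure_measure_of[OF surface_measure_def]) (use ca S in \<open>auto simp: sets_eq\<close>)
qed


section \<open>The space H1, weak gradients and traces\<close>

definition L2 :: "'a measure \<Rightarrow> ('a \<Rightarrow> 'b::euclidean_space) set" where
  "L2 M = {f \<in> borel_measurable M. integrable M (\<lambda>x. (norm (f x))\<^sup>2)}"

definition L2_norm :: "'a measure \<Rightarrow> ('a \<Rightarrow> 'b::euclidean_space) \<Rightarrow> real" where
  "L2_norm M f = sqrt (LINT x|M. (norm (f x))\<^sup>2)"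

definition grad :: "(real^3 \<Rightarrow> real) \<Rightarrow> real^3 \<Rightarrow> real^3" where
  "grad \<phi> x = (\<chi> i. frechet_derivative \<phi> (at x) (axis i 1))"

text \<open>Continuously differentiable functions on three-space with compact support contained in \<open>S\<close>;
  \<open>C1c UNIV\<close>, restricted to a domain, gives functions that are smooth up to the boundary.\<close>

definition C1c :: "(real^3) set \<Rightarrow> (real^3 \<Rightarrow> real) set" where
  "C1c S = {\<phi>. (\<forall>x. \<phi> differentiable (at x)) \<and> continuous_on UNIV (grad \<phi>) \<and>
                compact (closure {x. \<phi> x \<noteq> 0}) \<and> closure {x. \<phi> x \<noteq> 0} \<subseteq> S}"

definition has_weak_grad :: "(real^3) set \<Rightarrow> (real^3 \<Rightarrow> real) \<Rightarrow> (real^3 \<Rightarrow> real^3) \<Rightarrow> bool" where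
  "has_weak_grad \<Omega> u G \<longleftrightarrow> u \<in> L2 (lebesgue_on \<Omega>) \<and> G \<in> L2 (lebesgue_on \<Omega>) \<and>
     (\<forall>\<phi>\<in>C1c \<Omega>. (LINT x|lebesgue_on \<Omega>. u x *\<^sub>R grad \<phi> x) = - (LINT x|lebesgue_on \<Omega>. \<phi> x *\<^sub>R G x))"

definition H1 :: "(real^3) set \<Rightarrow> (real^3 \<Rightarrow> real) set" where
  "H1 \<Omega> = {u. \<exists>G. has_weak_grad \<Omega> u G}"

text \<open>The weak gradient is unique up to null sets of the open set \<open>\<Omega>\<close>.\<close>

definition weak_grad :: "(real^3) set \<Rightarrow> (real^3 \<Rightarrow> real) \<Rightarrow> real^3 \<Rightarrow> real^3" where
  "weak_grad \<Omega> u = (SOME G. has_weak_grad \<Omega> u G)"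

definition H1_norm :: "(real^3) set \<Rightarrow> (real^3 \<Rightarrow> real) \<Rightarrow> real" where
  "H1_norm \<Omega> u = sqrt ((L2_norm (lebesgue_on \<Omega>) u)\<^sup>2 + (L2_norm (lebesgue_on \<Omega>) (weak_grad \<Omega> u))\<^sup>2)"

abbreviation surface_on :: "(real^3) set \<Rightarrow> (real^3) measure" where
  "surface_on S \<equiv> restrict_space surface_measure S"

text \<open>The boundary regularity needed for boundary values to make sense: functions smooth up to the
  boundary are dense in H1, and there is a trace operator, i.e. a bounded linear map from H1 to
  L2 of the boundary which extends restriction. Both hold on Lipschitz domains; density makes
  the trace operator unique up to null sets.\<close>

definition smooth_dense_in_H1 :: "(real^3) set \<Rightarrow> bool" where
  "smooth_dense_in_H1 \<Omega> \<longleftrightarrow>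
     (\<forall>v\<in>H1 \<Omega>. \<forall>\<epsilon>>0. \<exists>\<phi>\<in>C1c UNIV. \<phi> \<in> H1 \<Omega> \<and> H1_norm \<Omega> (\<lambda>x. v x - \<phi> x) < \<epsilon>)"

definition trace_operator :: "(real^3) set \<Rightarrow> ((real^3 \<Rightarrow> real) \<Rightarrow> real^3 \<Rightarrow> real) \<Rightarrow> bool" where
  "trace_operator \<Omega> T \<longleftrightarrow>
     (\<forall>v\<in>H1 \<Omega>. T v \<in> L2 (surface_on (frontier \<Omega>))) \<and>
     (\<forall>v\<in>H1 \<Omega>. \<forall>w\<in>H1 \<Omega>. \<forall>a b. AE y in surface_on (frontier \<Omega>).
         T (\<lambda>x. a * v x + b * w x) y = a * T v y + b * T w y) \<and>
     (\<exists>C. \<forall>v\<in>H1 \<Omega>. L2_norm (surface_on (frontier \<Omega>)) (T v) \<le> C * H1_norm \<Omega> v) \<and>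
     (\<forall>\<phi>\<in>C1c UNIV. AE y in surface_on (frontier \<Omega>). T \<phi> y = \<phi> y)"

definition H1_D :: "(real^3) set \<Rightarrow> (real^3) set \<Rightarrow> (real^3 \<Rightarrow> real) \<Rightarrow>
    ((real^3 \<Rightarrow> real) \<Rightarrow> real^3 \<Rightarrow> real) \<Rightarrow> (real^3 \<Rightarrow> real) set" where
  "H1_D \<Omega> D g T = {u \<in> H1 \<Omega>. AE y in surface_on D. T u y = g y}"

definition H1_0 :: "(real^3) set \<Rightarrow> (real^3) set \<Rightarrow>
    ((real^3 \<Rightarrow> real) \<Rightarrow> real^3 \<Rightarrow> real) \<Rightarrow> (real^3 \<Rightarrow> real) set" where
  "H1_0 \<Omega> D T = {v \<in> H1 \<Omega>. AE y in surface_on D. T v y = 0}"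

definition order_interval :: "(real^3) set \<Rightarrow> real \<Rightarrow> real \<Rightarrow> (real^3 \<Rightarrow> real) set" where
  "order_interval \<Omega> lo hi = {u. AE x in lebesgue_on \<Omega>. lo \<le> u x \<and> u x \<le> hi}"

section \<open>Weak form and energy of the Hamiltonian constraint\<close>

text \<open>The arguments \<open>\<tau>2\<close> and \<open>\<sigma>2\<close> are the functions written as squares in the equation.\<close>

definition weak_solution :: "(real^3) set \<Rightarrow> (real^3) set \<Rightarrow> (real^3) set \<Rightarrow>
    ((real^3 \<Rightarrow> real) \<Rightarrow> real^3 \<Rightarrow> real) \<Rightarrow> (real^3 \<Rightarrow> real^3^3) \<Rightarrow> (real^3 \<Rightarrow> real) \<Rightarrow> (real^3 \<Rightarrow> real) \<Rightarrow>
    (real^3 \<Rightarrow> real) \<Rightarrow> (real^3 \<Rightarrow> real) \<Rightarrow> (real^3 \<Rightarrow> real) \<Rightarrow> (real^3 \<Rightarrow> real) \<Rightarrow> (real^3 \<Rightarrow> real) \<Rightarrow> bool" where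
  "weak_solution \<Omega> D N T a R \<tau>2 \<sigma>2 \<rho> c g\<^sub>N u \<longleftrightarrow>
     (\<forall>v\<in>H1_0 \<Omega> D T.
        (LINT x|lebesgue_on \<Omega>. (a x *v weak_grad \<Omega> u x) \<bullet> weak_grad \<Omega> v x
           + (R x / 8 * u x + \<tau>2 x / 12 * u x ^ 5 - \<sigma>2 x / 8 * u x powi (-7)
              - 2 * pi * \<rho> x * u x powi (-3)) * v x)
        + (LINT y|surface_on N. (c y * T u y - g\<^sub>N y) * T v y) = 0)"

definition energy :: "(real^3) set \<Rightarrow> (real^3) set \<Rightarrow>
    ((real^3 \<Rightarrow> real) \<Rightarrow> real^3 \<Rightarrow> real) \<Rightarrow> (real^3 \<Rightarrow> real^3^3) \<Rightarrow> (real^3 \<Rightarrow> real) \<Rightarrow> (real^3 \<Rightarrow> real) \<Rightarrow>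
    (real^3 \<Rightarrow> real) \<Rightarrow> (real^3 \<Rightarrow> real) \<Rightarrow> (real^3 \<Rightarrow> real) \<Rightarrow> (real^3 \<Rightarrow> real) \<Rightarrow> (real^3 \<Rightarrow> real) \<Rightarrow> real" where
  "energy \<Omega> N T a R \<tau>2 \<sigma>2 \<rho> c g\<^sub>N u =
     (LINT x|lebesgue_on \<Omega>. 1/2 * ((a x *v weak_grad \<Omega> u x) \<bullet> weak_grad \<Omega> u x)
        + 1/16 * R x * (u x)\<^sup>2 + 1/72 * \<tau>2 x * u x ^ 6 + 1/48 * \<sigma>2 x * u x powi (-6)
        + pi * \<rho> x * u x powi (-2))
     + 1/2 * (LINT y|surface_on N. c y * (T u y)\<^sup>2) - (LINT y|surface_on N. g\<^sub>N y * T u y)"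

text \<open>The energy makes sense on functions whose values lie in some strictly positive or strictly
  negative interval; elsewhere the negative powers need not be integrable, and \<open>LINT\<close> would
  return the junk value 0.\<close>

definition energy_domain :: "(real^3) set \<Rightarrow> (real^3 \<Rightarrow> real) set" where
  "energy_domain \<Omega> = {w \<in> H1 \<Omega>. \<exists>lo hi. (0 < lo \<or> hi < 0) \<and> w \<in> order_interval \<Omega> lo hi}"

text \<open>The Gateaux derivative at \<open>u\<close> of a functional \<open>F\<close> with domain \<open>K\<close>, as a bounded linear functional
  \<open>L\<close> on the space \<open>V\<close> of directions. The derivative at 0 of \<open>F\<close> along \<open>u + t v\<close> only has a
  meaning if this line stays in \<open>K\<close> for small \<open>t\<close>, which for the energy fails when \<open>v\<close> is unbounded;
  on the remaining directions \<open>L\<close> is determined by continuity.\<close>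

definition has_gateaux_derivative :: "((real^3 \<Rightarrow> real) \<Rightarrow> real) \<Rightarrow> (real^3 \<Rightarrow> real) set \<Rightarrow>
    (real^3 \<Rightarrow> real) set \<Rightarrow> ((real^3 \<Rightarrow> real) \<Rightarrow> real) \<Rightarrow> (real^3 \<Rightarrow> real) \<Rightarrow>
    ((real^3 \<Rightarrow> real) \<Rightarrow> real) \<Rightarrow> bool" where
  "has_gateaux_derivative F K V nrm u L \<longleftrightarrow>
     (\<forall>v\<in>V. \<forall>w\<in>V. \<forall>a b. L (\<lambda>x. a * v x + b * w x) = a * L v + b * L w) \<and>
     (\<exists>C. \<forall>v\<in>V. \<bar>L v\<bar> \<le> C * nrm v) \<and>
     (\<forall>v\<in>V. (\<forall>\<^sub>F t in nhds 0. (\<lambda>x. u x + t * v x) \<in> K) \<longrightarrow>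
        ((\<lambda>t. F (\<lambda>x. u x + t * v x)) has_real_derivative L v) (at 0))"

definition critical_point :: "((real^3 \<Rightarrow> real) \<Rightarrow> real) \<Rightarrow> (real^3 \<Rightarrow> real) set \<Rightarrow>
    (real^3 \<Rightarrow> real) set \<Rightarrow> ((real^3 \<Rightarrow> real) \<Rightarrow> real) \<Rightarrow> (real^3 \<Rightarrow> real) \<Rightarrow> bool" where
  "critical_point F K V nrm u \<longleftrightarrow>
     (\<exists>L. has_gateaux_derivative F K V nrm u L \<and> (\<forall>v\<in>V. L v = 0))"

end

theory Submission
  imports Defs "HOL-Real_Asymp.Real_Asymp"
begin

text \<open>The energy is differentiable along a bounded direction \<open>v\<close>, by dominated convergence of the
  difference quotients, and its derivative at \<open>u\<close> is the weak form tested with \<open>v\<close>. Since \<open>u\<close> stays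
  away from zero, the directions in which the energy is defined near \<open>u\<close> are exactly the bounded ones,
  so a weak solution is a critical point with derivative \<open>0\<close>. Conversely, an unbounded test function
  \<open>v\<close> is approximated by \<open>k arctan (v / k)\<close> as \<open>k \<rightarrow> \<infinity>\<close>. These truncations are again test functions by
  the chain rule for weak gradients and traces, which is inherited from the functions smooth up to the
  boundary, and dominated convergence passes the weak form to the limit. Additivity of the weak
  gradient rests on its uniqueness.\<close>

section \<open>Square integrable functions\<close>

text \<open>The obstacle is that \<open>u + t v\<close> may leave every interval avoiding 0 for each
  \<open>t \<noteq> 0\<close> when \<open>v\<close> is unbounded, so differentiability along lines
  says nothing directly about such \<open>v\<close>. The truncations that bridge the gap have to
  respect the condition on \<open>D\<close>, which is a condition on traces. A profile \<psi> with
  \<psi>(0) = 0, |\<psi>(s)| \<le> |s| and a continuous derivative bounded by 1 meets both demands: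
  it commutes with weak gradients and traces almost everywhere, and \<open>v\<close>, its gradient
  and its trace dominate the truncated quantities. The scaled arctan is such a profile, being
  bounded and, unlike a cut-off by minimum and maximum, continuously differentiable.

  The weak form is finite on all of \<open>H1\<close> although the coefficients are merely square
  integrable: |u| lies between two positive constants, so every power of \<open>u\<close> is
  bounded. Weak gradients are chosen representatives and \<open>T\<close> is linear only up to null
  sets, which is why the identities between them hold almost everywhere.\<close>

lemma L2_measurable: "f \<in> L2 M \<Longrightarrow> f \<in> borel_measurable M"
  by (simp add: L2_def)

lemma L2_integrable: "f \<in> L2 M \<Longrightarrow> integrable M (\<lambda>x. (norm (f x))\<^sup>2)"
  by (simp add: L2_def)

lemma L2_dominated:
  assumes g: "g \<in> L2 M" and f: "f \<in> borel_measurable M"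
    and le: "AE x in M. norm (f x) \<le> C * norm (g x)"
  shows "f \<in> L2 M"
proof -
  have "integrable M (\<lambda>x. C\<^sup>2 * (norm (g x))\<^sup>2)"
    using L2_integrable[OF g] by simp
  then have "integrable M (\<lambda>x. (norm (f x))\<^sup>2)"
  proof (rule Bochner_Integration.integrable_bound)
    show "AE x in M. norm ((norm (f x))\<^sup>2) \<le> norm (C\<^sup>2 * (norm (g x))\<^sup>2)"
      using le
    proof eventually_elim
      case (elim x)
      then have "(norm (f x))\<^sup>2 \<le> (C * norm (g x))\<^sup>2" by (intro power_mono) auto
      then show ?case by (simp add: power_mult_distrib)
    qed
  qed (use f in measurable)
  with f show ?thesis by (simp add: L2_def)
qed

lemma L2_mult_bounded:
  fixes w f :: "'a \<Rightarrow> real"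
  assumes w: "w \<in> L2 M" and f: "f \<in> borel_measurable M" and bound: "AE x in M. \<bar>f x\<bar> \<le> B"
  shows "(\<lambda>x. w x * f x) \<in> L2 M"
proof (rule L2_dominated[OF w, of _ B])
  show "(\<lambda>x. w x * f x) \<in> borel_measurable M" using L2_measurable[OF w] f by measurable
  show "AE x in M. norm (w x * f x) \<le> B * norm (w x)"
    using bound
  proof eventually_elim
    case (elim x)
    then have "\<bar>w x\<bar> * \<bar>f x\<bar> \<le> \<bar>w x\<bar> * B" by (intro mult_left_mono) auto
    then show ?case by (simp add: abs_mult mult.commute)
  qed
qed

lemma L2_integrable_norm_mult:
  assumes f: "f \<in> L2 M" and g: "g \<in> L2 M"
  shows "integrable M (\<lambda>x. norm (f x) * norm (g x))"
proof (rule Bochner_Integration.integrable_bound)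
  show "integrable M (\<lambda>x. (norm (f x))\<^sup>2 + (norm (g x))\<^sup>2)"
    using L2_integrable[OF f] L2_integrable[OF g] by simp
  show "AE x in M. norm (norm (f x) * norm (g x)) \<le> norm ((norm (f x))\<^sup>2 + (norm (g x))\<^sup>2)"
  proof (rule AE_I2)
    fix x
    show "norm (norm (f x) * norm (g x)) \<le> norm ((norm (f x))\<^sup>2 + (norm (g x))\<^sup>2)"
      using sum_squares_bound[of "norm (f x)" "norm (g x)"]
      mult_nonneg_nonneg[OF norm_ge_zero[of "f x"] norm_ge_zero[of "g x"]]
      unfolding real_norm_def abs_mult abs_norm_cancel by linarith
  qed
qed (use f[THEN L2_measurable] g[THEN L2_measurable] in measurable)

lemma L2_lincomb:
  assumes f: "f \<in> L2 M" and g: "g \<in> L2 M"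
  shows "(\<lambda>x. a *\<^sub>R f x + b *\<^sub>R g x) \<in> L2 M"
proof -
  note [measurable] = f[THEN L2_measurable] g[THEN L2_measurable]
  have "integrable M (\<lambda>x. (norm (a *\<^sub>R f x + b *\<^sub>R g x))\<^sup>2)"
  proof (rule Bochner_Integration.integrable_bound)
    show "integrable M (\<lambda>x. 2 * (a\<^sup>2 * (norm (f x))\<^sup>2) + 2 * (b\<^sup>2 * (norm (g x))\<^sup>2))"
      using L2_integrable[OF f] L2_integrable[OF g] by simp
    show "AE x in M. norm ((norm (a *\<^sub>R f x + b *\<^sub>R g x))\<^sup>2)
        \<le> norm (2 * (a\<^sup>2 * (norm (f x))\<^sup>2) + 2 * (b\<^sup>2 * (norm (g x))\<^sup>2))"
    proof (rule AE_I2)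
      fix x
      have "norm (a *\<^sub>R f x + b *\<^sub>R g x) \<le> \<bar>a\<bar> * norm (f x) + \<bar>b\<bar> * norm (g x)"
        by (rule norm_triangle_le) simp
      then have "(norm (a *\<^sub>R f x + b *\<^sub>R g x))\<^sup>2 \<le> (\<bar>a\<bar> * norm (f x) + \<bar>b\<bar> * norm (g x))\<^sup>2"
        by (intro power_mono) auto
      also have "\<dots> \<le> 2 * (\<bar>a\<bar> * norm (f x))\<^sup>2 + 2 * (\<bar>b\<bar> * norm (g x))\<^sup>2"
        using sum_squares_bound[of "\<bar>a\<bar> * norm (f x)" "\<bar>b\<bar> * norm (g x)"] by (simp add: power2_sum)
      finally show "norm ((norm (a *\<^sub>R f x + b *\<^sub>R g x))\<^sup>2)
          \<le> norm (2 * (a\<^sup>2 * (norm (f x))\<^sup>2) + 2 * (b\<^sup>2 * (norm (g x))\<^sup>2))"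
        by (simp add: power_mult_distrib)
    qed
  qed measurable
  then show ?thesis by (simp add: L2_def)
qed

lemma L2_diff: "f \<in> L2 M \<Longrightarrow> g \<in> L2 M \<Longrightarrow> (\<lambda>x. f x - g x) \<in> L2 M"
  using L2_lincomb[of f M g 1 "-1"] by simp

text \<open>A general bounded bilinear \<open>h\<close> covers multiplication, scalar multiplication
  and the inner product at once: the product of the norms dominates up to a constant, and continuity
  of \<open>h\<close> gives measurability.\<close>

lemma L2_integrable_bilinear:
  fixes f :: "'x \<Rightarrow> 'a::euclidean_space" and g :: "'x \<Rightarrow> 'b::euclidean_space"
    and h :: "'a \<Rightarrow> 'b \<Rightarrow> 'c::euclidean_space"
  assumes h: "bounded_bilinear h" and f: "f \<in> L2 M" and g: "g \<in> L2 M"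
  shows "integrable M (\<lambda>x. h (f x) (g x))"
proof -
  obtain K where K: "0 \<le> K" "\<And>a b. norm (h a b) \<le> norm a * norm b * K"
    using bounded_bilinear.nonneg_bounded[OF h] by blast
  have "(\<lambda>x. h (f x) (g x)) \<in> borel_measurable M"
    by (rule borel_measurable_continuous_Pair[OF f[THEN L2_measurable] g[THEN L2_measurable]])
       (intro bounded_bilinear.continuous_on[OF h] continuous_intros)
  moreover have "integrable M (\<lambda>x. K * (norm (f x) * norm (g x)))"
    using L2_integrable_norm_mult[OF f g] by simp
  moreover have "norm (h (f x) (g x)) \<le> norm (K * (norm (f x) * norm (g x)))" for x
    using K(1) K(2)[of "f x" "g x"] by (simp add: abs_mult mult_ac)
  ultimately show ?thesis
    using Bochner_Integration.integrable_bound[of M "\<lambda>x. K * (norm (f x) * norm (g x))" "\<lambda>x. h (f x) (g x)"]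
    by blast
qed

text \<open>Discriminant argument for the form
  \<open>s\<^sup>2 * A - 2 * s * t * C + t\<^sup>2 * B\<close>, which is the integral of a square.
  The choice \<open>s = B\<close>, \<open>t = C\<close> gives
  \<open>0 \<le> B * (A * B - C\<^sup>2)\<close>, conclusive when \<open>B > 0\<close>.\<close>

lemma L2_Cauchy_Schwarz:
  assumes f: "f \<in> L2 M" and g: "g \<in> L2 M"
  shows "(LINT x|M. norm (f x) * norm (g x)) \<le> L2_norm M f * L2_norm M g"
proof -
  define A where "A = (LINT x|M. (norm (f x))\<^sup>2)"
  define B where "B = (LINT x|M. (norm (g x))\<^sup>2)"
  define C where "C = (LINT x|M. norm (f x) * norm (g x))"
  have nonneg: "0 \<le> A" "0 \<le> B" "0 \<le> C" by (auto simp: A_def B_def C_def)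
  have quad: "0 \<le> s\<^sup>2 * A - 2 * s * t * C + t\<^sup>2 * B" for s t
  proof -
    have "0 \<le> (LINT x|M. (s * norm (f x) - t * norm (g x))\<^sup>2)" by simp
    also have "\<dots> = (LINT x|M. s\<^sup>2 * (norm (f x))\<^sup>2 - (2 * s * t) * (norm (f x) * norm (g x))
        + t\<^sup>2 * (norm (g x))\<^sup>2)"
      by (simp add: power2_diff power_mult_distrib algebra_simps)
    also have "\<dots> = s\<^sup>2 * A - 2 * s * t * C + t\<^sup>2 * B"
      using L2_integrable[OF f] L2_integrable[OF g] L2_integrable_norm_mult[OF f g]
      by (simp add: A_def B_def C_def)
    finally show ?thesis .
  qed
  have "C\<^sup>2 \<le> A * B"
  proof (cases "B = 0")
    case True
    have "C = 0"
    proof (rule ccontr)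
      assume "C \<noteq> 0"
      then have "C > 0" using nonneg by simp
      \<comment> \<open>For \<open>B = 0\<close> the form at \<open>s = 1\<close>,
        \<open>t = (A + 1) / C\<close> has the value \<open>- A - 2\<close>, which is
        negative.\<close>
      then have "2 * 1 * ((A + 1) / C) * C = 2 * (A + 1)" by simp
      then show False using quad[of 1 "(A + 1) / C"] True nonneg by auto
    qed
    then show ?thesis using True by simp
  next
    case False
    then have "0 < B" using nonneg by simp
    moreover have "0 \<le> B * (A * B - C\<^sup>2)"
      using quad[of B C] by (simp add: power2_eq_square algebra_simps)
    ultimately show ?thesis by (simp add: zero_le_mult_iff)
  qed
  then have "C \<le> sqrt (A * B)" by (rule real_le_rsqrt)
  then show ?thesis by (simp add: A_def B_def C_def L2_norm_def real_sqrt_mult)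
qed

text \<open>Cauchy-Schwarz bounds the error by the norm distance times the norm of the fixed factor.
  This is how the defining identity of a weak gradient survives a limit.\<close>

lemma L2_tendsto_integral_bilinear:
  fixes f :: "'x \<Rightarrow> 'a::euclidean_space" and g :: "'x \<Rightarrow> 'b::euclidean_space"
    and h :: "'a \<Rightarrow> 'b \<Rightarrow> 'c::euclidean_space"
  assumes h: "bounded_bilinear h" and f: "f \<in> L2 M" and g: "g \<in> L2 M" and F: "\<And>n. F n \<in> L2 M"
    and lim: "(\<lambda>n. L2_norm M (\<lambda>x. f x - F n x)) \<longlonglongrightarrow> 0"
  shows "(\<lambda>n. LINT x|M. h (F n x) (g x)) \<longlonglongrightarrow> (LINT x|M. h (f x) (g x))"
proof -
  obtain K where K: "\<And>a b. norm (h a b) \<le> norm a * norm b * K" "0 \<le> K"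
    using bounded_bilinear.nonneg_bounded[OF h] by blast
  have bound: "norm ((LINT x|M. h (F n x) (g x)) - (LINT x|M. h (f x) (g x)))
      \<le> (L2_norm M (\<lambda>x. f x - F n x) * L2_norm M g) * K" for n
  proof -
    have d: "(\<lambda>x. f x - F n x) \<in> L2 M" by (intro L2_diff f F)
    have "(LINT x|M. h (F n x) (g x)) - (LINT x|M. h (f x) (g x))
        = (LINT x|M. h (F n x) (g x) - h (f x) (g x))"
      by (intro Bochner_Integration.integral_diff[symmetric] L2_integrable_bilinear[OF h] f g F)
    also have "\<dots> = - (LINT x|M. h (f x - F n x) (g x))"
      by (subst Bochner_Integration.integral_minus[symmetric]) (simp add: bounded_bilinear.diff_left[OF h])
    finally have "norm ((LINT x|M. h (F n x) (g x)) - (LINT x|M. h (f x) (g x)))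
        = norm (LINT x|M. h (f x - F n x) (g x))" by simp
    also have "\<dots> \<le> (LINT x|M. norm (h (f x - F n x) (g x)))"
      by (rule integral_norm_bound)
    also have "\<dots> \<le> (LINT x|M. norm (f x - F n x) * norm (g x) * K)"
      using L2_integrable_norm_mult[OF d g] K
      by (intro integral_mono integrable_norm L2_integrable_bilinear[OF h] d g) auto
    also have "\<dots> = (LINT x|M. norm (f x - F n x) * norm (g x)) * K" by simp
    also have "\<dots> \<le> (L2_norm M (\<lambda>x. f x - F n x) * L2_norm M g) * K"
      by (intro mult_right_mono L2_Cauchy_Schwarz d g K)
    finally show ?thesis .
  qed
  have "(\<lambda>n. (L2_norm M (\<lambda>x. f x - F n x) * L2_norm M g) * K) \<longlonglongrightarrow> 0"
    by (intro tendsto_mult_left_zero lim)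
  then have "(\<lambda>n. (LINT x|M. h (F n x) (g x)) - (LINT x|M. h (f x) (g x))) \<longlonglongrightarrow> 0"
    by (rule Lim_null_comparison[rotated]) (use bound in auto)
  then show ?thesis by (simp add: LIM_zero_iff)
qed

section \<open>From norm convergence to almost everywhere convergence, and restriction to
  subsets\<close>

lemma L2_norm_nonneg: "0 \<le> L2_norm M f"
  by (simp add: L2_norm_def)

lemma L2_norm_power2: "(L2_norm M f)\<^sup>2 = (LINT x|M. (norm (f x))\<^sup>2)"
  by (simp add: L2_norm_def)

text \<open>The squared distances tend to 0 in L1, and L1 convergence has an almost everywhere
  convergent subsequence.\<close>

lemma L2_tendsto_AE_subseq:
  fixes f :: "'x \<Rightarrow> 'a::euclidean_space"
  assumes f: "f \<in> L2 M" and F: "\<And>n. F n \<in> L2 M"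
    and lim: "(\<lambda>n. L2_norm M (\<lambda>x. f x - F n x)) \<longlonglongrightarrow> 0"
  obtains r :: "nat \<Rightarrow> nat" where "strict_mono r" "AE x in M. (\<lambda>n. F (r n) x) \<longlonglongrightarrow> f x"
proof -
  have "(\<lambda>n. (L2_norm M (\<lambda>x. f x - F n x))\<^sup>2) \<longlonglongrightarrow> 0\<^sup>2"
    by (intro tendsto_intros lim)
  then have "(\<lambda>n. LINT x|M. norm ((norm (f x - F n x))\<^sup>2)) \<longlonglongrightarrow> 0"
    by (simp add: L2_norm_power2)
  then obtain r :: "nat \<Rightarrow> nat" where r: "strict_mono r"
      "AE x in M. (\<lambda>n. (norm (f x - F (r n) x))\<^sup>2) \<longlonglongrightarrow> 0"
    using tendsto_L1_AE_subseq[of M "\<lambda>n x. (norm (f x - F n x))\<^sup>2"] L2_integrable[OF L2_diff[OF f F]]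
    by blast
  have "AE x in M. (\<lambda>n. F (r n) x) \<longlonglongrightarrow> f x"
    using r(2)
  proof eventually_elim
    case (elim x)
    then have "(\<lambda>n. sqrt ((norm (f x - F (r n) x))\<^sup>2)) \<longlonglongrightarrow> sqrt 0"
      by (intro tendsto_intros)
    then have "(\<lambda>n. norm (F (r n) x - f x)) \<longlonglongrightarrow> 0" by (simp add: norm_minus_commute)
    then show ?case by (simp add: tendsto_norm_zero_iff LIM_zero_iff)
  qed
  with r(1) that show thesis by blast
qed

text \<open>Traces are given on the whole frontier, while the boundary integrals are taken over
  \<open>N\<close> alone; this carries square integrability over.\<close>

lemma L2_restrict_space_mono:
  assumes A: "A \<in> sets M" "A \<subseteq> B" and B: "B \<in> sets M" and f: "f \<in> L2 (restrict_space M B)"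
  shows "f \<in> L2 (restrict_space M A)"
proof -
  have "f \<in> borel_measurable (restrict_space M A)"
    using L2_measurable[OF f] A(2) by (rule measurable_restrict_mono)
  moreover have "integrable (restrict_space M A) (\<lambda>x. (norm (f x))\<^sup>2)"
  proof -
    have "integrable M (\<lambda>x. indicator B x *\<^sub>R (norm (f x))\<^sup>2)"
      using L2_integrable[OF f] B by (subst (asm) integrable_restrict_space) auto
    from integrable_mult_indicator[OF A(1) this]
    have "integrable M (\<lambda>x. indicator A x *\<^sub>R (indicator B x *\<^sub>R (norm (f x))\<^sup>2))" .
    moreover have "(\<lambda>x. indicator A x *\<^sub>R (indicator B x *\<^sub>R (norm (f x))\<^sup>2)) = (\<lambda>x. indicator A x *\<^sub>R (norm (f x))\<^sup>2)"
      using A(2) by (auto simp: fun_eq_iff of_bool_def indicator_def)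
    ultimately show ?thesis using A(1) by (subst integrable_restrict_space) auto
  qed
  ultimately show ?thesis by (simp add: L2_def)
qed

lemma AE_restrict_space_mono:
  assumes "A \<in> sets M" "A \<subseteq> B" "B \<in> sets M" "AE x in restrict_space M B. P x"
  shows "AE x in restrict_space M A. P x"
  using assms by (auto simp: AE_restrict_space_iff sets.sets_into_space Int_absorb2 elim: eventually_mono)

section \<open>Continuously differentiable functions with compact support\<close>

lemma has_derivative_grad:
  assumes "\<phi> differentiable (at x)"
  shows "(\<phi> has_derivative (\<lambda>h. grad \<phi> x \<bullet> h)) (at x)"
proof -
  let ?D = "frechet_derivative \<phi> (at x)"
  have D: "(\<phi> has_derivative ?D) (at x)"
    using assms frechet_derivative_works by blast
  then have lin: "linear ?D" by (rule has_derivative_linear)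
  have "?D h = grad \<phi> x \<bullet> h" for h
  proof -
    have "?D h = ?D (\<Sum>i\<in>UNIV. h $ i *s axis i 1)" by (simp add: basis_expansion)
    also have "\<dots> = (\<Sum>i\<in>UNIV. h $ i * ?D (axis i 1))"
      using lin by (simp add: linear_sum linear_cmul scalar_mult_eq_scaleR)
    also have "\<dots> = grad \<phi> x \<bullet> h" by (simp add: grad_def inner_vec_def mult.commute)
    finally show ?thesis .
  qed
  with D show ?thesis by (metis (no_types, lifting) ext)
qed

lemma grad_eqI:
  assumes "(\<phi> has_derivative (\<lambda>h. g \<bullet> h)) (at x)"
  shows "grad \<phi> x = g"
  using frechet_derivative_at[OF assms, symmetric]
  by (simp add: grad_def vec_eq_iff inner_axis)

text \<open>Any compact set outside which the function vanishes may serve as \<open>K\<close>, so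
  the closure of the support never has to be computed in applications.\<close>

lemma C1cI:
  assumes d: "\<And>x. (\<phi> has_derivative (\<lambda>h. g x \<bullet> h)) (at x)" and g: "continuous_on UNIV g"
    and K: "compact K" "K \<subseteq> S" "\<And>x. x \<notin> K \<Longrightarrow> \<phi> x = 0"
  shows "\<phi> \<in> C1c S" "grad \<phi> = g"
proof -
  show [simp]: "grad \<phi> = g" using grad_eqI[OF d] by auto
  have "closure {x. \<phi> x \<noteq> 0} \<subseteq> K"
    using K by (intro closure_minimal compact_imp_closed) auto
  then have "compact (closure {x. \<phi> x \<noteq> 0})" "closure {x. \<phi> x \<noteq> 0} \<subseteq> S"
    using K by (auto intro: compact_closure[THEN iffD2] bounded_subset[OF compact_imp_bounded[OF K(1)] order_trans[OF closure_subset]])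
  then show "\<phi> \<in> C1c S"
    using d g by (auto simp: C1c_def differentiable_def)
qed

lemma C1c_has_derivative: "\<phi> \<in> C1c S \<Longrightarrow> (\<phi> has_derivative (\<lambda>h. grad \<phi> x \<bullet> h)) (at x)"
  by (simp add: C1c_def has_derivative_grad)

lemma C1c_continuous_on: "\<phi> \<in> C1c S \<Longrightarrow> continuous_on A \<phi>"
  by (meson C1c_has_derivative has_derivative_continuous continuous_at_imp_continuous_on)

lemma C1c_continuous_on_grad: "\<phi> \<in> C1c S \<Longrightarrow> continuous_on UNIV (grad \<phi>)"
  by (simp add: C1c_def)

text \<open>The complement of the support is open and the function is 0 on it, so its derivative is
  0 there too; one compact set serves the function and its gradient.\<close>

lemma C1c_support:
  assumes "\<phi> \<in> C1c S"
  obtains K where "compact K" "K \<subseteq> S" "\<And>x. x \<notin> K \<Longrightarrow> \<phi> x = 0" "\<And>x. x \<notin> K \<Longrightarrow> grad \<phi> x = 0"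
proof -
  define K where "K = closure {x. \<phi> x \<noteq> 0}"
  have K: "compact K" "K \<subseteq> S" using assms by (auto simp: C1c_def K_def)
  have zero: "\<phi> x = 0" if "x \<notin> K" for x
    using that closure_subset[of "{x. \<phi> x \<noteq> 0}"] by (auto simp: K_def)
  have "open (- K)" using K(1) by (simp add: compact_imp_closed open_Compl)
  have "grad \<phi> x = 0" if "x \<notin> K" for x
  proof (rule grad_eqI)
    have "((\<lambda>_. 0) has_derivative (\<lambda>h. 0 \<bullet> h)) (at x)" by simp
    then show "(\<phi> has_derivative (\<lambda>h. 0 \<bullet> h)) (at x)"
      by (rule has_derivative_transform_within_open[OF _ \<open>open (- K)\<close>]) (use that zero in simp_all)
  qed
  with K zero that show thesis by metis
qed

lemma bounded_continuous_compact_support: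
  fixes f :: "'a::topological_space \<Rightarrow> 'b::real_normed_vector"
  assumes "continuous_on UNIV f" "compact K" "\<And>x. x \<notin> K \<Longrightarrow> f x = 0"
  obtains B where "0 \<le> B" "\<And>x. norm (f x) \<le> B"
proof -
  have "bounded (f ` K)"
    using assms by (intro compact_imp_bounded compact_continuous_image) (auto intro: continuous_on_subset)
  then obtain B where "0 < B" "\<And>x. x \<in> K \<Longrightarrow> norm (f x) \<le> B"
    by (auto simp: bounded_pos)
  then show thesis using assms(3) by (intro that[of B]) (auto, metis less_imp_le norm_zero)
qed

lemma integrable_continuous_compact_support:
  fixes f :: "'a::euclidean_space \<Rightarrow> 'b::euclidean_space"
  assumes "continuous_on UNIV f" "compact K" "\<And>x. x \<notin> K \<Longrightarrow> f x = 0"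
  shows "integrable lborel f"
proof -
  have "integrable lborel (\<lambda>x. indicator K x *\<^sub>R f x)"
    using assms by (intro borel_integrable_compact) (auto intro: continuous_on_subset)
  also have "(\<lambda>x. indicator K x *\<^sub>R f x) = f"
    using assms(3) by (auto simp: fun_eq_iff indicator_def)
  finally show ?thesis .
qed

lemma L2_continuous_compact_support:
  fixes f :: "'a::euclidean_space \<Rightarrow> 'b::euclidean_space"
  assumes f: "continuous_on UNIV f" and K: "compact K" "\<And>x. x \<notin> K \<Longrightarrow> f x = 0"
    and S: "S \<in> sets lebesgue"
  shows "f \<in> L2 (lebesgue_on S)"
proof -
  have fm: "f \<in> borel_measurable borel" by (rule borel_measurable_continuous_onI[OF f])
  then have f_leb: "f \<in> borel_measurable lebesgue" by (simp add: measurable_completion)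
  have "integrable lborel (\<lambda>x. (norm (f x))\<^sup>2)"
    using K by (intro integrable_continuous_compact_support[of _ K] continuous_intros f) auto
  then have "integrable lebesgue (\<lambda>x. (norm (f x))\<^sup>2)"
    using fm by (subst integrable_completion) auto
  then have "integrable (lebesgue_on S) (\<lambda>x. (norm (f x))\<^sup>2)"
    using S integrable_mult_indicator[of S lebesgue "\<lambda>x. (norm (f x))\<^sup>2"]
    by (simp add: integrable_restrict_space)
  then show ?thesis
    using f_leb by (simp add: L2_def measurable_restrict_space1)
qed

lemma C1c_L2:
  assumes "\<phi> \<in> C1c S" "A \<in> sets lebesgue"
  shows "\<phi> \<in> L2 (lebesgue_on A)" "grad \<phi> \<in> L2 (lebesgue_on A)"
proof -
  obtain K where K: "compact K" "\<And>x. x \<notin> K \<Longrightarrow> \<phi> x = 0" "\<And>x. x \<notin> K \<Longrightarrow> grad \<phi> x = 0"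
    using C1c_support[OF assms(1)] by metis
  show "\<phi> \<in> L2 (lebesgue_on A)" "grad \<phi> \<in> L2 (lebesgue_on A)"
    using K assms by (auto intro: L2_continuous_compact_support C1c_continuous_on C1c_continuous_on_grad)
qed

text \<open>The product takes its support condition from \<eta>. Hence a function smooth up to the
  boundary times a test function on \<Omega> is again a test function on \<Omega>.\<close>

lemma C1c_mult:
  assumes \<phi>: "\<phi> \<in> C1c S" and \<eta>: "\<eta> \<in> C1c S'"
  shows "(\<lambda>x. \<phi> x * \<eta> x) \<in> C1c S'" "grad (\<lambda>x. \<phi> x * \<eta> x) = (\<lambda>x. \<phi> x *\<^sub>R grad \<eta> x + \<eta> x *\<^sub>R grad \<phi> x)"
proof -
  obtain K where K: "compact K" "K \<subseteq> S'" "\<And>x. x \<notin> K \<Longrightarrow> \<eta> x = 0"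
    using C1c_support[OF \<eta>] by metis
  have d: "((\<lambda>x. \<phi> x * \<eta> x) has_derivative (\<lambda>h. (\<phi> x *\<^sub>R grad \<eta> x + \<eta> x *\<^sub>R grad \<phi> x) \<bullet> h)) (at x)" for x
    using has_derivative_mult[OF C1c_has_derivative[OF \<phi>] C1c_has_derivative[OF \<eta>]]
    by (simp add: inner_add_left mult.commute)
  have c: "continuous_on UNIV (\<lambda>x. \<phi> x *\<^sub>R grad \<eta> x + \<eta> x *\<^sub>R grad \<phi> x)"
    by (intro continuous_intros C1c_continuous_on[OF \<phi>] C1c_continuous_on[OF \<eta>]
      C1c_continuous_on_grad[OF \<phi>] C1c_continuous_on_grad[OF \<eta>])
  show "(\<lambda>x. \<phi> x * \<eta> x) \<in> C1c S'" "grad (\<lambda>x. \<phi> x * \<eta> x) = (\<lambda>x. \<phi> x *\<^sub>R grad \<eta> x + \<eta> x *\<^sub>R grad \<phi> x)"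
    by (rule C1cI[OF d c K(1,2)]; simp add: K)+
qed

text \<open>\<open>\<psi> 0 = 0\<close> keeps the support compact: the composition vanishes wherever
  the inner function does.\<close>

lemma C1c_compose:
  assumes \<phi>: "\<phi> \<in> C1c S" and \<psi>: "\<And>s. (\<psi> has_real_derivative \<psi>' s) (at s)"
    and cont: "continuous_on UNIV \<psi>'" and zero: "\<psi> 0 = 0"
  shows "(\<lambda>x. \<psi> (\<phi> x)) \<in> C1c S" "grad (\<lambda>x. \<psi> (\<phi> x)) = (\<lambda>x. \<psi>' (\<phi> x) *\<^sub>R grad \<phi> x)"
proof -
  obtain K where K: "compact K" "K \<subseteq> S" "\<And>x. x \<notin> K \<Longrightarrow> \<phi> x = 0"
    using C1c_support[OF \<phi>] by metis
  have d: "((\<lambda>x. \<psi> (\<phi> x)) has_derivative (\<lambda>h. (\<psi>' (\<phi> x) *\<^sub>R grad \<phi> x) \<bullet> h)) (at x)" for x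
    using has_derivative_compose[OF C1c_has_derivative[OF \<phi>] \<psi>[THEN has_field_derivative_imp_has_derivative]]
    by (simp add: mult.commute)
  have c: "continuous_on UNIV (\<lambda>x. \<psi>' (\<phi> x) *\<^sub>R grad \<phi> x)"
    by (intro continuous_intros C1c_continuous_on_grad[OF \<phi>] continuous_on_compose2[OF cont C1c_continuous_on[OF \<phi>]]) auto
  show "(\<lambda>x. \<psi> (\<phi> x)) \<in> C1c S" "grad (\<lambda>x. \<psi> (\<phi> x)) = (\<lambda>x. \<psi>' (\<phi> x) *\<^sub>R grad \<phi> x)"
    by (rule C1cI[OF d c K(1,2)]; simp add: K zero)+
qed

section \<open>Integration by parts for compactly supported functions\<close>

lemma integral_lborel_translate:
  fixes f :: "'a::euclidean_space \<Rightarrow> 'b::euclidean_space"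
  assumes "f \<in> borel_measurable borel"
  shows "(LINT x|lborel. f (c + x)) = (LINT x|lborel. f x)"
proof -
  have "(LINT x|lborel. f (c + x)) = (LINT x|distr lborel borel ((+) c). f x)"
    using assms by (intro integral_distr[symmetric]) auto
  then show ?thesis by (simp add: lborel_distr_plus)
qed

text \<open>Translation invariance makes every difference quotient integrate to 0, and dominated
  convergence passes this on to the directional derivatives. It is the divergence theorem without
  boundary term.\<close>

lemma integral_grad_C1c:
  assumes \<phi>: "\<phi> \<in> C1c S"
  shows "(LINT x|lborel. grad \<phi> x) = 0"
proof -
  obtain K where K: "compact K" "\<And>x. x \<notin> K \<Longrightarrow> \<phi> x = 0" "\<And>x. x \<notin> K \<Longrightarrow> grad \<phi> x = 0"
    using C1c_support[OF \<phi>] by metis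
  obtain B where B: "0 \<le> B" "\<And>x. norm (grad \<phi> x) \<le> B"
    using bounded_continuous_compact_support[OF C1c_continuous_on_grad[OF \<phi>] K(1,3)] by metis
  obtain r where r: "K \<subseteq> cball 0 r"
    using compact_imp_bounded[OF K(1)] by (meson bounded_subset_ballD ball_subset_cball order_trans)
  then have Kr: "norm y \<le> r" if "y \<in> K" for y using that by (auto dest: subsetD)
  have int_\<phi>: "integrable lborel \<phi>" and int_g: "integrable lborel (grad \<phi>)"
    using integrable_continuous_compact_support[OF C1c_continuous_on[OF \<phi>] K(1,2)]
      integrable_continuous_compact_support[OF C1c_continuous_on_grad[OF \<phi>] K(1,3)] by blast+
  have lip: "\<bar>\<phi> y - \<phi> x\<bar> \<le> B * norm (y - x)" for x y
  proof -
    have "onorm (\<lambda>h. grad \<phi> z \<bullet> h) \<le> B" for z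
    proof (rule onorm_le)
      fix h
      have "norm (grad \<phi> z \<bullet> h) \<le> norm (grad \<phi> z) * norm h"
        using Cauchy_Schwarz_ineq2[of "grad \<phi> z" h] by simp
      also have "\<dots> \<le> B * norm h" by (intro mult_right_mono B norm_ge_zero)
      finally show "norm (grad \<phi> z \<bullet> h) \<le> B * norm h" .
    qed
    then show ?thesis
      using differentiable_bound[of UNIV \<phi> "\<lambda>z h. grad \<phi> z \<bullet> h" B y x] C1c_has_derivative[OF \<phi>] by simp
  qed
  have "(LINT x|lborel. grad \<phi> x \<bullet> e) = 0" for e
  proof -
    define s where "s n = inverse (real (Suc n))" for n
    have s: "0 < s n" "s n \<le> 1" for n by (auto simp: s_def field_simps)
    have s_lim: "s \<longlonglongrightarrow> 0" unfolding s_def by (rule LIMSEQ_inverse_real_of_nat)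
    define q where "q n x = (\<phi> (s n *\<^sub>R e + x) - \<phi> x) / s n" for n x
    have q_meas: "q n \<in> borel_measurable borel" for n
    proof (rule borel_measurable_continuous_onI)
      show "continuous_on UNIV (q n)"
        using s(1)[of n] unfolding q_def
        by (intro continuous_intros continuous_on_compose2[OF C1c_continuous_on[OF \<phi>, of UNIV]] C1c_continuous_on[OF \<phi>]) auto
    qed
    have \<phi>_meas: "\<phi> \<in> borel_measurable borel"
      using C1c_continuous_on[OF \<phi>] by (rule borel_measurable_continuous_onI)
    have q_int: "(LINT x|lborel. q n x) = 0" for n
    proof -
      have "integrable lborel (\<lambda>x. \<phi> (s n *\<^sub>R e + x))"
      proof -
        have "integrable (distr lborel borel ((+) (s n *\<^sub>R e))) \<phi>"
          using int_\<phi> by (simp add: lborel_distr_plus)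
        then show ?thesis
          using \<phi>_meas by (subst (asm) integrable_distr_eq) auto
      qed
      then show ?thesis
        using int_\<phi> by (simp add: q_def integral_lborel_translate[OF \<phi>_meas])
    qed
    have "(\<lambda>n. LINT x|lborel. q n x) \<longlonglongrightarrow> (LINT x|lborel. grad \<phi> x \<bullet> e)"
    \<comment> \<open>The gradient bound is a Lipschitz constant, so each quotient is at most
      \<open>B * norm e\<close>. Steps of length at most 1 keep all translated supports in the ball
      of radius \<open>r + norm e\<close>.\<close>
    proof (rule integral_dominated_convergence[where w="\<lambda>x. indicator (cball 0 (r + norm e)) x *\<^sub>R (B * norm e)"])
      show "(\<lambda>x. grad \<phi> x \<bullet> e) \<in> borel_measurable lborel" using int_g by auto
      show "q n \<in> borel_measurable lborel" for n using q_meas by simp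
      show "integrable lborel (\<lambda>x. indicator (cball 0 (r + norm e)) x *\<^sub>R (B * norm e))"
        by (intro borel_integrable_compact) auto
      show "AE x in lborel. (\<lambda>n. q n x) \<longlonglongrightarrow> grad \<phi> x \<bullet> e"
      proof (rule AE_I2)
        fix x
        have "((\<lambda>t. \<phi> (t *\<^sub>R e + x)) has_derivative (\<lambda>t. grad \<phi> (0 *\<^sub>R e + x) \<bullet> (t *\<^sub>R e))) (at 0)"
          by (rule has_derivative_compose[OF _ C1c_has_derivative[OF \<phi>], of _ "\<lambda>t. t *\<^sub>R e" ]) (auto intro!: derivative_eq_intros)
        then have "((\<lambda>t. \<phi> (t *\<^sub>R e + x)) has_real_derivative (grad \<phi> x \<bullet> e)) (at 0)"
          by (simp add: has_field_derivative_def mult.commute[of _ "grad \<phi> x \<bullet> e"] mult_commute_abs)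
        then have "((\<lambda>t. (\<phi> (t *\<^sub>R e + x) - \<phi> x) / t) \<longlongrightarrow> grad \<phi> x \<bullet> e) (at 0)"
          by (simp add: DERIV_def)
        moreover have "filterlim s (at 0) sequentially"
          using s s_lim by (auto simp: filterlim_at intro!: always_eventually) (metis less_irrefl)
        ultimately show "(\<lambda>n. q n x) \<longlonglongrightarrow> grad \<phi> x \<bullet> e"
          unfolding q_def by (rule filterlim_compose)
      qed
      show "AE x in lborel. norm (q n x) \<le> indicator (cball 0 (r + norm e)) x *\<^sub>R (B * norm e)" for n
      proof (rule AE_I2)
        fix x
        show "norm (q n x) \<le> indicator (cball 0 (r + norm e)) x *\<^sub>R (B * norm e)"
        proof (cases "x \<in> cball 0 (r + norm e)")
          case True
          have "\<bar>\<phi> (s n *\<^sub>R e + x) - \<phi> x\<bar> \<le> B * (s n * norm e)"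
            using lip[of "s n *\<^sub>R e + x" x] s[of n] by simp
          then show ?thesis
            using True s[of n] by (simp add: q_def field_simps)
        next
          case False
          then have far: "r + norm e < norm x" by simp
          have "norm (s n *\<^sub>R e) \<le> 1 * norm e"
            unfolding norm_scaleR using s[of n] by (intro mult_right_mono) auto
          moreover have "norm x \<le> norm (s n *\<^sub>R e + x) + norm (s n *\<^sub>R e)"
            using norm_triangle_ineq4[of "s n *\<^sub>R e + x" "s n *\<^sub>R e"] by simp
          ultimately have "s n *\<^sub>R e + x \<notin> K" "x \<notin> K"
            using Kr[of "s n *\<^sub>R e + x"] Kr[of x] far norm_ge_zero[of e] by linarith+
          then show ?thesis using K(2) False by (simp add: q_def)
        qed
      qed
    qed
    then show ?thesis using q_int by (simp add: LIMSEQ_const_iff)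
  qed
  then have "(LINT x|lborel. grad \<phi> x) \<bullet> e = 0" for e
    using integral_inner_left[OF int_g, of e] by simp
  then show ?thesis by (metis inner_eq_zero_iff)
qed

text \<open>The product of \<phi> with a test function has compact support, so its gradient
  integrates to 0; the product rule splits this integral into the two sides of the defining
  identity.\<close>

lemma C1c_has_weak_grad:
  assumes \<Omega>: "open \<Omega>" and \<phi>: "\<phi> \<in> C1c S"
  shows "has_weak_grad \<Omega> \<phi> (grad \<phi>)"
  unfolding has_weak_grad_def
proof (intro conjI ballI)
  have leb: "\<Omega> \<in> sets lebesgue" using \<Omega> by (simp add: borel_open)
  show L2\<phi>: "\<phi> \<in> L2 (lebesgue_on \<Omega>)" "grad \<phi> \<in> L2 (lebesgue_on \<Omega>)"
    using C1c_L2[OF \<phi> leb] .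
  fix \<eta> assume \<eta>: "\<eta> \<in> C1c \<Omega>"
  note L2\<eta> = C1c_L2[OF \<eta> leb]
  let ?g = "\<lambda>x. \<phi> x *\<^sub>R grad \<eta> x + \<eta> x *\<^sub>R grad \<phi> x"
  obtain K where K: "K \<subseteq> \<Omega>" "\<And>x. x \<notin> K \<Longrightarrow> \<eta> x = 0" "\<And>x. x \<notin> K \<Longrightarrow> grad \<eta> x = 0"
    using C1c_support[OF \<eta>] by metis
  have cont: "continuous_on UNIV ?g"
    by (intro continuous_intros C1c_continuous_on[OF \<phi>] C1c_continuous_on[OF \<eta>]
      C1c_continuous_on_grad[OF \<phi>] C1c_continuous_on_grad[OF \<eta>])
  have "(LINT x|lebesgue_on \<Omega>. ?g x) = (LINT x|lebesgue. indicator \<Omega> x *\<^sub>R ?g x)"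
    using leb by (simp add: integral_restrict_space)
  \<comment> \<open>Both \<eta> and its gradient vanish outside \<Omega>, so the integral may be
    taken over the whole space.\<close>
  also have "(\<lambda>x. indicator \<Omega> x *\<^sub>R ?g x) = ?g"
    using K subsetD[OF K(1)] by (force simp: indicator_def fun_eq_iff)
  also have "(LINT x|lebesgue. ?g x) = (LINT x|lborel. ?g x)"
    using borel_measurable_continuous_onI[OF cont] by (intro integral_completion) simp
  also have "\<dots> = 0"
    using integral_grad_C1c[OF C1c_mult(1)[OF \<phi> \<eta>]] by (simp add: C1c_mult(2)[OF \<phi> \<eta>])
  finally have "(LINT x|lebesgue_on \<Omega>. ?g x) = 0" .
  moreover have "(LINT x|lebesgue_on \<Omega>. ?g x)
      = (LINT x|lebesgue_on \<Omega>. \<phi> x *\<^sub>R grad \<eta> x) + (LINT x|lebesgue_on \<Omega>. \<eta> x *\<^sub>R grad \<phi> x)"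
    by (intro Bochner_Integration.integral_add L2_integrable_bilinear[OF bounded_bilinear_scaleR] L2\<phi> L2\<eta>)
  ultimately show "(LINT x|lebesgue_on \<Omega>. \<phi> x *\<^sub>R grad \<eta> x) = - (LINT x|lebesgue_on \<Omega>. \<eta> x *\<^sub>R grad \<phi> x)"
    by (simp add: eq_neg_iff_add_eq_0)
qed

section \<open>Uniqueness of weak gradients\<close>

text \<open>Squaring removes the kink of the positive part at 0, where the quotient is at most |h|.
  This yields C1 bump functions from elementary operations.\<close>

lemma has_real_derivative_max0_power2:
  "((\<lambda>t::real. (max 0 t)\<^sup>2) has_real_derivative 2 * max 0 t) (at t)"
proof (cases t "0::real" rule: linorder_cases)
  case less
  have "((\<lambda>_. 0) has_real_derivative 2 * max 0 t) (at t)" using less by simp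
  then show ?thesis
    by (rule has_field_derivative_transform_within_open[of _ _ _ "{..<0}"]) (use less in auto)
next
  case greater
  have "((\<lambda>t. t\<^sup>2) has_real_derivative 2 * max 0 t) (at t)"
    using greater by (auto intro!: derivative_eq_intros)
  then show ?thesis
    by (rule has_field_derivative_transform_within_open[of _ _ _ "{0<..}"]) (use greater in auto)
next
  case equal
  have "((\<lambda>h::real. (max 0 h)\<^sup>2 / h) \<longlongrightarrow> 0) (at 0)"
  proof (rule Lim_null_comparison)
    show "\<forall>\<^sub>F h::real in at 0. norm ((max 0 h)\<^sup>2 / h) \<le> \<bar>h\<bar>"
      by (rule always_eventually) (auto simp: max_def power2_eq_square)
    show "((\<lambda>h::real. \<bar>h\<bar>) \<longlongrightarrow> 0) (at 0)" by (intro tendsto_rabs_zero tendsto_ident_at)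
  qed
  then show ?thesis using equal by (simp add: DERIV_def)
qed

text \<open>\<open>p x i\<close> is positive exactly when the coordinate of \<open>x\<close> lies
  strictly between the two faces, so the product of the squared positive parts is C1 and nonzero
  exactly on the open box.\<close>

lemma C1c_box:
  fixes a b :: "real^3"
  assumes ab: "\<And>i. i \<in> Basis \<Longrightarrow> a \<bullet> i < b \<bullet> i" and S: "cbox a b \<subseteq> S"
  obtains w where "w \<in> C1c S" "\<And>x. w x \<noteq> 0 \<longleftrightarrow> x \<in> box a b"
proof -
  define p where "p x i = (x \<bullet> i - a \<bullet> i) * (b \<bullet> i - x \<bullet> i)" for x i :: "real^3"
  define w where "w x = (\<Prod>i\<in>Basis. (max 0 (p x i))\<^sup>2)" for x
  define g where "g x = (\<Sum>i\<in>Basis. ((\<Prod>j\<in>Basis - {i}. (max 0 (p x j))\<^sup>2)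
      * (2 * max 0 (p x i) * (a \<bullet> i + b \<bullet> i - 2 * (x \<bullet> i)))) *\<^sub>R i)" for x
  have "((\<lambda>x. (max 0 (p x i))\<^sup>2) has_derivative
      (\<lambda>h. (2 * max 0 (p x i) * (a \<bullet> i + b \<bullet> i - 2 * (x \<bullet> i))) * (h \<bullet> i))) (at x)" for x i
  proof -
    have "((\<lambda>x. p x i) has_derivative (\<lambda>h. (a \<bullet> i + b \<bullet> i - 2 * (x \<bullet> i)) * (h \<bullet> i))) (at x)"
      unfolding p_def by (auto intro!: derivative_eq_intros simp: algebra_simps)
    from has_derivative_compose[OF this has_real_derivative_max0_power2[THEN has_field_derivative_imp_has_derivative]]
    show ?thesis by (simp add: mult_ac)
  qed
  then have "(w has_derivative (\<lambda>h. \<Sum>i\<in>Basis. ((2 * max 0 (p x i) * (a \<bullet> i + b \<bullet> i - 2 * (x \<bullet> i))) * (h \<bullet> i))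
      * (\<Prod>j\<in>Basis - {i}. (max 0 (p x j))\<^sup>2))) (at x)" for x
    unfolding w_def by (rule has_derivative_prod)
  moreover have "(\<Sum>i\<in>Basis. ((2 * max 0 (p x i) * (a \<bullet> i + b \<bullet> i - 2 * (x \<bullet> i))) * (h \<bullet> i))
      * (\<Prod>j\<in>Basis - {i}. (max 0 (p x j))\<^sup>2)) = g x \<bullet> h" for x h
    unfolding g_def inner_sum_left by (intro sum.cong refl) (simp add: inner_commute[of h])
  ultimately have d: "(w has_derivative (\<lambda>h. g x \<bullet> h)) (at x)" for x
    by simp
  have c: "continuous_on UNIV g"
    unfolding g_def p_def by (intro continuous_intros)
  have wbox: "w x \<noteq> 0 \<longleftrightarrow> x \<in> box a b" for x
  proof -
    \<comment> \<open>The two factors of \<open>p\<close> cannot both be negative because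
      \<open>a \<bullet> i < b \<bullet> i\<close>.\<close>
    have "max 0 (p x i) \<noteq> 0 \<longleftrightarrow> a \<bullet> i < x \<bullet> i \<and> x \<bullet> i < b \<bullet> i" if "i \<in> Basis" for i
      using ab[OF that] unfolding p_def by (auto simp: max_def zero_le_mult_iff)
    then show ?thesis by (auto simp: w_def mem_box)
  qed
  have "w x = 0" if "x \<notin> cbox a b" for x
    using that wbox[of x] box_subset_cbox[of a b] by blast
  then have "w \<in> C1c S" by (rule C1cI(1)[OF d c compact_cbox S])
  with wbox that show thesis by blast
qed

text \<open>This profile vanishes at 0, stays below 1 and tends to 1 at every other point as
  \<open>k\<close> grows. Applied to a bump function it produces test functions tending to the
  indicator of the box.\<close>

lemma has_real_derivative_saturation:
  "((\<lambda>s. (k * s)\<^sup>2 / (1 + (k * s)\<^sup>2)) has_real_derivative 2 * k\<^sup>2 * s / (1 + (k * s)\<^sup>2)\<^sup>2) (at s)"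
proof -
  have "1 + (k * s)\<^sup>2 \<noteq> 0" by (metis add_pos_nonneg less_irrefl zero_le_power2 zero_less_one)
  then show ?thesis
    by (auto intro!: derivative_eq_intros simp: power2_eq_square algebra_simps)
qed

lemma saturation_tendsto:
  "(\<lambda>n. (real n * s)\<^sup>2 / (1 + (real n * s)\<^sup>2)) \<longlonglongrightarrow> of_bool (s \<noteq> 0)"
proof (cases "s = 0")
  case False
  then have "s\<^sup>2 > 0" by simp
  have "(\<lambda>n. (real n)\<^sup>2 * s\<^sup>2 / (1 + (real n)\<^sup>2 * s\<^sup>2)) \<longlonglongrightarrow> 1"
    using \<open>s\<^sup>2 > 0\<close> by real_asymp
  then show ?thesis using False by (simp add: power_mult_distrib)
qed simp

text \<open>Saturated bump functions converge to the indicator of a box, and the Lebesgue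
  differentiation theorem for cubes turns vanishing box integrals into vanishing almost everywhere.\<close>

lemma L2_orthogonal_C1c_imp_AE_zero:
  fixes G :: "real^3 \<Rightarrow> real^3"
  assumes \<Omega>: "open \<Omega>" and G: "G \<in> L2 (lebesgue_on \<Omega>)"
    and orth: "\<And>\<phi>. \<phi> \<in> C1c \<Omega> \<Longrightarrow> (LINT x|lebesgue_on \<Omega>. \<phi> x *\<^sub>R G x) = 0"
  shows "AE x in lebesgue_on \<Omega>. G x = 0"
proof -
  have leb: "\<Omega> \<in> sets lebesgue" using \<Omega> by (simp add: borel_open)
  define f where "f x = indicator \<Omega> x *\<^sub>R G x" for x
  have prod_int: "integrable lebesgue (\<lambda>x. \<phi> x *\<^sub>R f x)" if "\<phi> \<in> L2 (lebesgue_on \<Omega>)" for \<phi> :: "real^3 \<Rightarrow> real"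
  proof -
    have "integrable (lebesgue_on \<Omega>) (\<lambda>x. \<phi> x *\<^sub>R G x)"
      by (rule L2_integrable_bilinear[OF bounded_bilinear_scaleR that G])
    then show ?thesis
      using leb by (simp add: integrable_restrict_space f_def mult.commute)
  qed
  have ind_L2: "(indicator (cbox a b) :: real^3 \<Rightarrow> real) \<in> L2 (lebesgue_on \<Omega>)" for a b :: "real^3"
  proof -
    have "integrable lebesgue (\<lambda>x::real^3. indicator \<Omega> x *\<^sub>R (indicator (cbox a b) x :: real))"
      using leb lmeasurable_cbox by (intro integrable_mult_indicator) (auto simp: lmeasurable_iff_integrable)
    then have "integrable (lebesgue_on \<Omega>) (indicator (cbox a b) :: real^3 \<Rightarrow> real)"
      using leb by (simp add: integrable_restrict_space)
    moreover have "(\<lambda>x. (norm (indicator (cbox a b) x :: real))\<^sup>2) = indicator (cbox a b)"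
      by (auto simp: indicator_def)
    ultimately show ?thesis by (auto simp: L2_def)
  qed
  have f_box: "f absolutely_integrable_on cbox a b" for a b
    using prod_int[OF ind_L2] by (simp add: set_integrable_def)
  have box_zero: "integral (cbox a b) f = 0"
    if ab: "\<And>i. i \<in> Basis \<Longrightarrow> a \<bullet> i < b \<bullet> i" and sub: "cbox a b \<subseteq> \<Omega>" for a b
  proof -
    have open_box: "f absolutely_integrable_on box a b"
      using box_subset_cbox by (rule set_integrable_subset[OF f_box, rotated]) auto
    obtain w where w: "w \<in> C1c \<Omega>" "\<And>x. w x \<noteq> 0 \<longleftrightarrow> x \<in> box a b"
      using C1c_box[OF ab sub] by metis
    define \<phi> where "\<phi> n x = (real n * w x)\<^sup>2 / (1 + (real n * w x)\<^sup>2)" for n x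
    have \<phi>: "\<phi> n \<in> C1c \<Omega>" for n
    proof -
      have "continuous_on UNIV (\<lambda>s. 2 * (real n)\<^sup>2 * s / (1 + (real n * s)\<^sup>2)\<^sup>2)"
        by (intro continuous_intros) (metis add_pos_nonneg less_irrefl zero_le_power2 zero_less_one power_not_zero)
      then show ?thesis
        unfolding \<phi>_def by (rule C1c_compose(1)[OF w(1) has_real_derivative_saturation]) simp
    qed
    have "(\<lambda>n. LINT x|lebesgue. \<phi> n x *\<^sub>R f x) \<longlonglongrightarrow> (LINT x|lebesgue. indicator (box a b) x *\<^sub>R f x)"
    \<comment> \<open>The saturated functions take values in [0, 1] and vanish outside the box, so
      \<open>f\<close> on the closed box dominates.\<close>
    proof (rule integral_dominated_convergence[where w="\<lambda>x. norm (indicator (cbox a b) x *\<^sub>R f x)"])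
      show "(\<lambda>x. indicator (box a b) x *\<^sub>R f x) \<in> borel_measurable lebesgue"
        using open_box unfolding set_integrable_def by (rule borel_measurable_integrable)
      show "(\<lambda>x. \<phi> n x *\<^sub>R f x) \<in> borel_measurable lebesgue" for n
        using prod_int[OF C1c_L2(1)[OF \<phi> leb]] by auto
      show "integrable lebesgue (\<lambda>x. norm (indicator (cbox a b) x *\<^sub>R f x))"
        using f_box by (intro integrable_norm) (simp add: set_integrable_def)
      show "AE x in lebesgue. (\<lambda>n. \<phi> n x *\<^sub>R f x) \<longlonglongrightarrow> indicator (box a b) x *\<^sub>R f x"
      proof (rule AE_I2)
        fix x
        have "(\<lambda>n. \<phi> n x) \<longlonglongrightarrow> indicator (box a b) x"
          using saturation_tendsto[of "w x"] by (simp add: \<phi>_def w(2) indicator_def)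
        then show "(\<lambda>n. \<phi> n x *\<^sub>R f x) \<longlonglongrightarrow> indicator (box a b) x *\<^sub>R f x"
          by (intro tendsto_intros)
      qed
      show "AE x in lebesgue. norm (\<phi> n x *\<^sub>R f x) \<le> norm (indicator (cbox a b) x *\<^sub>R f x)" for n
      proof (rule AE_I2)
        fix x
        have "\<bar>\<phi> n x\<bar> \<le> indicator (cbox a b) x"
        proof (cases "w x = 0")
          case False
          then have "x \<in> cbox a b" using w(2) box_subset_cbox by blast
          have "t / (1 + t) \<le> 1" if "0 \<le> t" for t :: real
            using that by (simp add: divide_simps)
          from this[of "(real n * w x)\<^sup>2"] have "\<phi> n x \<le> 1" by (simp only: \<phi>_def zero_le_power2)
          moreover have "0 \<le> \<phi> n x" by (simp add: \<phi>_def)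
          ultimately show ?thesis using \<open>x \<in> cbox a b\<close> by simp
        qed (simp add: \<phi>_def)
        then show "norm (\<phi> n x *\<^sub>R f x) \<le> norm (indicator (cbox a b) x *\<^sub>R f x)"
          by (simp add: mult_right_mono)
      qed
    qed
    moreover have "(LINT x|lebesgue. \<phi> n x *\<^sub>R f x) = 0" for n
      using orth[OF \<phi>[of n]] leb by (simp add: integral_restrict_space f_def mult.commute)
    ultimately have "(LINT x:box a b|lebesgue. f x) = 0"
      by (simp add: LIMSEQ_const_iff set_lebesgue_integral_def)
    then have "integral (box a b) f = 0"
      using set_lebesgue_integral_eq_integral(2)[OF open_box] by simp
    then show ?thesis by (simp add: integral_open_interval)
  qed
  \<comment> \<open>The cubes in question have \<open>x\<close> as a corner, not as the
    centre.\<close>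
  obtain N where N: "negligible N" and diff: "\<And>x e. \<lbrakk>x \<notin> N; 0 < e\<rbrakk> \<Longrightarrow>
      \<exists>d>0. \<forall>h. 0 < h \<and> h < d \<longrightarrow> norm (integral (cbox x (x + h *\<^sub>R One)) f /\<^sub>R h ^ DIM(real^3) - f x) < e"
    by (rule integrable_ccontinuous_explicit[OF set_lebesgue_integral_eq_integral(1)[OF f_box]]) (rule that)
  have zero: "G x = 0" if x: "x \<in> \<Omega>" "x \<notin> N" for x
  proof -
    obtain r where r: "0 < r" "cball x r \<subseteq> \<Omega>" using \<Omega> x(1) open_contains_cball by blast
    have "norm (f x) < e" if e: "0 < e" for e
    proof -
      obtain d where d: "0 < d" "\<And>h. 0 < h \<Longrightarrow> h < d \<Longrightarrow>
          norm (integral (cbox x (x + h *\<^sub>R One)) f /\<^sub>R h ^ DIM(real^3) - f x) < e"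
        using diff[OF x(2) e] by blast
      \<comment> \<open>A point of the cube differs from \<open>x\<close> by at most
        \<open>h\<close> in each of three coordinates, hence by at most \<open>3 * h\<close>;
        \<open>r / 3\<close> keeps the cube in the ball and \<open>d / 2\<close> makes
        \<open>h < d\<close> strict.\<close>
      define h where "h = min (d / 2) (r / 3)"
      have h: "0 < h" "h < d" "3 * h \<le> r" using d r by (auto simp: h_def)
      have "cbox x (x + h *\<^sub>R One) \<subseteq> cball x r"
      proof
        fix y assume y: "y \<in> cbox x (x + h *\<^sub>R One)"
        have "norm (y - x) \<le> (\<Sum>i\<in>Basis. \<bar>(y - x) \<bullet> i\<bar>)" by (rule norm_le_l1)
        also have "\<dots> \<le> (\<Sum>i\<in>(Basis :: (real^3) set). h)"
          using y h(1) by (intro sum_mono) (auto simp: mem_box inner_diff_left inner_add_left)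
        also have "\<dots> \<le> r" using h(3) by simp
        finally show "y \<in> cball x r" by (simp add: dist_norm norm_minus_commute)
      qed
      then have "integral (cbox x (x + h *\<^sub>R One)) f = 0"
        using r(2) h(1) by (intro box_zero) (auto simp: inner_add_left)
      then show ?thesis using d(2)[OF h(1,2)] by simp
    qed
    then have "norm (f x) \<le> 0" by (meson less_irrefl not_le)
    then show ?thesis using x by (simp add: f_def)
  qed
  have "AE x in lebesgue. x \<notin> N"
    using N negligible_iff_null_sets AE_not_in by blast
  then have "AE x in lebesgue. x \<in> \<Omega> \<longrightarrow> G x = 0"
    by eventually_elim (use zero in auto)
  then show ?thesis using leb by (simp add: AE_restrict_space_iff)
qed

section \<open>Chain rule for weak gradients and traces\<close>

lemma L2_norm_cong_AE:
  assumes "f \<in> borel_measurable M" "g \<in> borel_measurable M" "AE x in M. f x = g x"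
  shows "L2_norm M f = L2_norm M g"
proof -
  have "(LINT x|M. (norm (f x))\<^sup>2) = (LINT x|M. (norm (g x))\<^sup>2)"
    using assms by (intro integral_cong_AE) auto
  then show ?thesis by (simp add: L2_norm_def)
qed

section \<open>Linearity and uniqueness of weak gradients\<close>

lemma has_weak_gradD:
  assumes "has_weak_grad \<Omega> u G"
  shows "u \<in> L2 (lebesgue_on \<Omega>)" "G \<in> L2 (lebesgue_on \<Omega>)"
    "\<phi> \<in> C1c \<Omega> \<Longrightarrow> (LINT x|lebesgue_on \<Omega>. u x *\<^sub>R grad \<phi> x) = - (LINT x|lebesgue_on \<Omega>. \<phi> x *\<^sub>R G x)"
  using assms by (auto simp: has_weak_grad_def)

lemma has_weak_grad_weak_grad: "u \<in> H1 \<Omega> \<Longrightarrow> has_weak_grad \<Omega> u (weak_grad \<Omega> u)"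
  unfolding H1_def weak_grad_def by (metis (mono_tags) mem_Collect_eq someI_ex)

lemma H1_L2: "u \<in> H1 \<Omega> \<Longrightarrow> u \<in> L2 (lebesgue_on \<Omega>)" "u \<in> H1 \<Omega> \<Longrightarrow> weak_grad \<Omega> u \<in> L2 (lebesgue_on \<Omega>)"
  using has_weak_grad_weak_grad has_weak_gradD by blast+

lemma has_weak_grad_imp_H1: "has_weak_grad \<Omega> u G \<Longrightarrow> u \<in> H1 \<Omega>"
  by (auto simp: H1_def)

lemma has_weak_grad_lincomb:
  assumes \<Omega>: "open \<Omega>" and u: "has_weak_grad \<Omega> u G" and v: "has_weak_grad \<Omega> v H"
  shows "has_weak_grad \<Omega> (\<lambda>x. a * u x + b * v x) (\<lambda>x. a *\<^sub>R G x + b *\<^sub>R H x)"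
  unfolding has_weak_grad_def
proof (intro conjI ballI)
  have leb: "\<Omega> \<in> sets lebesgue" using \<Omega> by (simp add: borel_open)
  note uD = has_weak_gradD[OF u] and vD = has_weak_gradD[OF v]
  show "(\<lambda>x. a * u x + b * v x) \<in> L2 (lebesgue_on \<Omega>)"
    using L2_lincomb[OF uD(1) vD(1), of a b] by simp
  show "(\<lambda>x. a *\<^sub>R G x + b *\<^sub>R H x) \<in> L2 (lebesgue_on \<Omega>)"
    by (intro L2_lincomb uD vD)
  fix \<phi> assume \<phi>: "\<phi> \<in> C1c \<Omega>"
  note L2\<phi> = C1c_L2[OF \<phi> leb]
  note int = L2_integrable_bilinear[OF bounded_bilinear_scaleR]
  have "(LINT x|lebesgue_on \<Omega>. (a * u x + b * v x) *\<^sub>R grad \<phi> x)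
      = (LINT x|lebesgue_on \<Omega>. a *\<^sub>R (u x *\<^sub>R grad \<phi> x) + b *\<^sub>R (v x *\<^sub>R grad \<phi> x))"
    by (simp add: scaleR_add_left)
  also have "\<dots> = a *\<^sub>R (LINT x|lebesgue_on \<Omega>. u x *\<^sub>R grad \<phi> x) + b *\<^sub>R (LINT x|lebesgue_on \<Omega>. v x *\<^sub>R grad \<phi> x)"
    using int[OF uD(1) L2\<phi>(2)] int[OF vD(1) L2\<phi>(2)] by (simp del: scaleR_scaleR)
  also have "\<dots> = - (a *\<^sub>R (LINT x|lebesgue_on \<Omega>. \<phi> x *\<^sub>R G x) + b *\<^sub>R (LINT x|lebesgue_on \<Omega>. \<phi> x *\<^sub>R H x))"
    using uD(3)[OF \<phi>] vD(3)[OF \<phi>] by simp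
  also have "a *\<^sub>R (LINT x|lebesgue_on \<Omega>. \<phi> x *\<^sub>R G x) + b *\<^sub>R (LINT x|lebesgue_on \<Omega>. \<phi> x *\<^sub>R H x)
      = (LINT x|lebesgue_on \<Omega>. a *\<^sub>R (\<phi> x *\<^sub>R G x) + b *\<^sub>R (\<phi> x *\<^sub>R H x))"
    using int[OF L2\<phi>(1) uD(2)] int[OF L2\<phi>(1) vD(2)] by (simp del: scaleR_scaleR)
  also have "\<dots> = (LINT x|lebesgue_on \<Omega>. \<phi> x *\<^sub>R (a *\<^sub>R G x + b *\<^sub>R H x))"
    by (simp add: scaleR_add_right mult.commute)
  finally show "(LINT x|lebesgue_on \<Omega>. (a * u x + b * v x) *\<^sub>R grad \<phi> x)
      = - (LINT x|lebesgue_on \<Omega>. \<phi> x *\<^sub>R (a *\<^sub>R G x + b *\<^sub>R H x))" .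
qed

lemma has_weak_grad_diff:
  assumes "open \<Omega>" "has_weak_grad \<Omega> u G" "has_weak_grad \<Omega> v H"
  shows "has_weak_grad \<Omega> (\<lambda>x. u x - v x) (\<lambda>x. G x - H x)"
  using has_weak_grad_lincomb[OF assms, of 1 "-1"] by simp

text \<open>The difference of two weak gradients of \<open>u\<close> is a weak gradient of 0, hence
  orthogonal to all test functions.\<close>

lemma weak_grad_AE_eq:
  assumes \<Omega>: "open \<Omega>" and G: "has_weak_grad \<Omega> u G"
  shows "AE x in lebesgue_on \<Omega>. weak_grad \<Omega> u x = G x"
proof -
  have "has_weak_grad \<Omega> u (weak_grad \<Omega> u)"
    using G by (intro has_weak_grad_weak_grad has_weak_grad_imp_H1)
  from has_weak_grad_diff[OF \<Omega> this G]
  have "has_weak_grad \<Omega> (\<lambda>x. 0) (\<lambda>x. weak_grad \<Omega> u x - G x)" by simp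
  then have "AE x in lebesgue_on \<Omega>. weak_grad \<Omega> u x - G x = 0"
    by (intro L2_orthogonal_C1c_imp_AE_zero[OF \<Omega>]) (auto dest: has_weak_gradD)
  then show ?thesis by simp
qed

section \<open>The norm of H1 through an arbitrary weak gradient\<close>

lemma H1_norm_nonneg: "0 \<le> H1_norm \<Omega> u"
  by (simp add: H1_norm_def)

text \<open>The norm is defined with the chosen representative \<open>weak_grad\<close>; uniqueness
  permits computing it with whichever weak gradient is at hand.\<close>

lemma H1_norm_power2_eq:
  assumes "open \<Omega>" "has_weak_grad \<Omega> u G"
  shows "(H1_norm \<Omega> u)\<^sup>2 = (L2_norm (lebesgue_on \<Omega>) u)\<^sup>2 + (L2_norm (lebesgue_on \<Omega>) G)\<^sup>2"
proof -
  have "L2_norm (lebesgue_on \<Omega>) (weak_grad \<Omega> u) = L2_norm (lebesgue_on \<Omega>) G"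
    using H1_L2(2)[OF has_weak_grad_imp_H1[OF assms(2)]] has_weak_gradD(2)[OF assms(2)]
    by (intro L2_norm_cong_AE weak_grad_AE_eq assms L2_measurable)
  then show ?thesis by (simp add: H1_norm_def)
qed

lemma H1_norm_tendsto_zero_iff:
  assumes "open \<Omega>" "\<And>n. has_weak_grad \<Omega> (u n) (G n)"
  shows "(\<lambda>n. H1_norm \<Omega> (u n)) \<longlonglongrightarrow> 0 \<longleftrightarrow>
    (\<lambda>n. L2_norm (lebesgue_on \<Omega>) (u n)) \<longlonglongrightarrow> 0 \<and> (\<lambda>n. L2_norm (lebesgue_on \<Omega>) (G n)) \<longlonglongrightarrow> 0"
    (is "?H \<longleftrightarrow> ?U \<and> ?G")
proof
  have H1: "H1_norm \<Omega> (u n) = sqrt ((L2_norm (lebesgue_on \<Omega>) (u n))\<^sup>2 + (L2_norm (lebesgue_on \<Omega>) (G n))\<^sup>2)" for n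
    using H1_norm_power2_eq[OF assms(1) assms(2)[of n]]
    by (metis H1_norm_def real_sqrt_abs abs_of_nonneg real_sqrt_ge_zero add_nonneg_nonneg zero_le_power2)
  show "?U \<and> ?G" if ?H
  proof
    show ?U
      by (rule tendsto_sandwich[OF _ _ tendsto_const that])
         (auto simp: H1 L2_norm_nonneg)
    show ?G
      by (rule tendsto_sandwich[OF _ _ tendsto_const that])
         (auto simp: H1 L2_norm_nonneg)
  qed
  assume "?U \<and> ?G"
  then have "(\<lambda>n. sqrt ((L2_norm (lebesgue_on \<Omega>) (u n))\<^sup>2 + (L2_norm (lebesgue_on \<Omega>) (G n))\<^sup>2)) \<longlonglongrightarrow> sqrt (0\<^sup>2 + 0\<^sup>2)"
    by (intro tendsto_intros) auto
  then show ?H by (simp add: H1)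
qed

text \<open>Convergence of the weak gradients needs an almost everywhere convergent subsequence of the smooth
  approximations, because the outer derivative is only continuous, not Lipschitz.\<close>

lemma H1_compose_approx:
  assumes \<Omega>: "open \<Omega>" and dense: "smooth_dense_in_H1 \<Omega>" and v: "v \<in> H1 \<Omega>"
    and \<psi>: "\<And>s. (\<psi> has_real_derivative \<psi>' s) (at s)" and cont: "continuous_on UNIV \<psi>'"
    and zero: "\<psi> 0 = 0" and bound: "\<And>s. \<bar>\<psi>' s\<bar> \<le> B"
  obtains \<phi> where "\<And>n. \<phi> n \<in> C1c UNIV" "(\<lambda>n. H1_norm \<Omega> (\<lambda>x. v x - \<phi> n x)) \<longlonglongrightarrow> 0"
    "has_weak_grad \<Omega> (\<lambda>x. \<psi> (v x)) (\<lambda>x. \<psi>' (v x) *\<^sub>R weak_grad \<Omega> v x)"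
    "(\<lambda>n. H1_norm \<Omega> (\<lambda>x. \<psi> (v x) - \<psi> (\<phi> n x))) \<longlonglongrightarrow> 0"
proof -
  let ?M = "lebesgue_on \<Omega>"
  have leb: "\<Omega> \<in> sets lebesgue" using \<Omega> by (simp add: borel_open)
  define G where "G = weak_grad \<Omega> v"
  have vG: "has_weak_grad \<Omega> v G" unfolding G_def by (rule has_weak_grad_weak_grad[OF v])
  note vD = has_weak_gradD[OF vG]
  have B: "0 \<le> B" using bound[of 0] by simp
  have cont\<psi>: "continuous_on UNIV \<psi>"
    using \<psi> by (meson DERIV_isCont continuous_at_imp_continuous_on)
  have [measurable]: "\<psi> \<in> borel_measurable borel" "\<psi>' \<in> borel_measurable borel"
    using cont\<psi> cont by (auto intro: borel_measurable_continuous_onI)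
  \<comment> \<open>The Lipschitz bound gives L2 convergence of the compositions at once and, with
    \<open>\<psi> 0 = 0\<close>, their square integrability.\<close>
  have lip: "\<bar>\<psi> s - \<psi> t\<bar> \<le> B * \<bar>s - t\<bar>" for s t
    using field_differentiable_bound[of UNIV \<psi> \<psi>' B s t] \<psi> bound by auto
  have "\<exists>\<phi>. \<phi> \<in> C1c UNIV \<and> H1_norm \<Omega> (\<lambda>x. v x - \<phi> x) < inverse (real (Suc n))" for n
    using dense v unfolding smooth_dense_in_H1_def by (metis inverse_positive_iff_positive of_nat_0_less_iff zero_less_Suc)
  then obtain \<phi>0 where \<phi>0: "\<And>n. \<phi>0 n \<in> C1c UNIV" "\<And>n. H1_norm \<Omega> (\<lambda>x. v x - \<phi>0 n x) < inverse (real (Suc n))"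
    by metis
  have H1_lim0: "(\<lambda>n. H1_norm \<Omega> (\<lambda>x. v x - \<phi>0 n x)) \<longlonglongrightarrow> 0"
    by (rule tendsto_sandwich[OF _ _ tendsto_const LIMSEQ_inverse_real_of_nat])
       (auto intro!: always_eventually less_imp_le[OF \<phi>0(2)] simp del: of_nat_Suc simp: H1_norm_nonneg)
  have diff0: "has_weak_grad \<Omega> (\<lambda>x. v x - \<phi>0 n x) (\<lambda>x. G x - grad (\<phi>0 n) x)" for n
    by (intro has_weak_grad_diff \<Omega> vG C1c_has_weak_grad[OF \<Omega> \<phi>0(1)])
  note L2_lim0 = H1_lim0[unfolded H1_norm_tendsto_zero_iff[OF \<Omega> diff0]]
  obtain r :: "nat \<Rightarrow> nat" where r: "strict_mono r" "AE x in ?M. (\<lambda>n. \<phi>0 (r n) x) \<longlonglongrightarrow> v x"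
    using L2_tendsto_AE_subseq[of v ?M \<phi>0] vD(1) C1c_L2(1)[OF \<phi>0(1) leb] L2_lim0 by blast
  define \<phi> where "\<phi> n = \<phi>0 (r n)" for n
  have \<phi>: "\<phi> n \<in> C1c UNIV" for n using \<phi>0 by (simp add: \<phi>_def)
  note L2\<phi> = C1c_L2[OF \<phi> leb]
  have H1_lim: "(\<lambda>n. H1_norm \<Omega> (\<lambda>x. v x - \<phi> n x)) \<longlonglongrightarrow> 0"
    using LIMSEQ_subseq_LIMSEQ[OF H1_lim0 r(1)] by (simp add: \<phi>_def comp_def)
  have L2_lim: "(\<lambda>n. L2_norm ?M (\<lambda>x. v x - \<phi> n x)) \<longlonglongrightarrow> 0"
     "(\<lambda>n. L2_norm ?M (\<lambda>x. G x - grad (\<phi> n) x)) \<longlonglongrightarrow> 0"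
    using L2_lim0 LIMSEQ_subseq_LIMSEQ[OF _ r(1)] by (auto simp: \<phi>_def comp_def)
  define H where "H x = \<psi>' (v x) *\<^sub>R G x" for x
  note [measurable] = L2_measurable[OF vD(1)] L2_measurable[OF vD(2)] L2_measurable[OF L2\<phi>(1)] L2_measurable[OF L2\<phi>(2)]
  have L2\<psi>v: "(\<lambda>x. \<psi> (v x)) \<in> L2 ?M"
    using lip[of _ 0] zero by (intro L2_dominated[OF vD(1), of _ B]) auto
  have L2H: "H \<in> L2 ?M"
    unfolding H_def using bound by (intro L2_dominated[OF vD(2), of _ B]) (auto intro!: mult_right_mono)
  have \<psi>\<phi>: "(\<lambda>x. \<psi> (\<phi> n x)) \<in> C1c UNIV" "grad (\<lambda>x. \<psi> (\<phi> n x)) = (\<lambda>x. \<psi>' (\<phi> n x) *\<^sub>R grad (\<phi> n) x)" for n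
    by (rule C1c_compose[OF \<phi> \<psi> cont zero])+
  note L2\<psi>\<phi> = C1c_L2[OF \<psi>\<phi>(1) leb, unfolded \<psi>\<phi>(2)]
  have lim1: "(\<lambda>n. L2_norm ?M (\<lambda>x. \<psi> (v x) - \<psi> (\<phi> n x))) \<longlonglongrightarrow> 0"
  proof (rule tendsto_sandwich[OF _ _ tendsto_const])
    show "(\<lambda>n. B * L2_norm ?M (\<lambda>x. v x - \<phi> n x)) \<longlonglongrightarrow> 0"
      by (intro tendsto_mult_right_zero L2_lim)
    have "L2_norm ?M (\<lambda>x. \<psi> (v x) - \<psi> (\<phi> n x)) \<le> B * L2_norm ?M (\<lambda>x. v x - \<phi> n x)" for n
    proof -
      have "(LINT x|?M. (norm (\<psi> (v x) - \<psi> (\<phi> n x)))\<^sup>2) \<le> (LINT x|?M. B\<^sup>2 * (norm (v x - \<phi> n x))\<^sup>2)"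
      proof (rule integral_mono)
        show "integrable ?M (\<lambda>x. (norm (\<psi> (v x) - \<psi> (\<phi> n x)))\<^sup>2)"
          by (intro L2_integrable L2_diff L2\<psi>v L2\<psi>\<phi>)
        show "integrable ?M (\<lambda>x. B\<^sup>2 * (norm (v x - \<phi> n x))\<^sup>2)"
          using L2_integrable[OF L2_diff[OF vD(1) L2\<phi>(1)]] by simp
        show "(norm (\<psi> (v x) - \<psi> (\<phi> n x)))\<^sup>2 \<le> B\<^sup>2 * (norm (v x - \<phi> n x))\<^sup>2" for x
          using power_mono[OF lip[of "v x" "\<phi> n x"], of 2] by (simp add: power_mult_distrib)
      qed
      then have "sqrt (LINT x|?M. (norm (\<psi> (v x) - \<psi> (\<phi> n x)))\<^sup>2) \<le> sqrt (B\<^sup>2 * (LINT x|?M. (norm (v x - \<phi> n x))\<^sup>2))"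
        by simp
      then show ?thesis using B by (simp add: L2_norm_def real_sqrt_mult)
    qed
    then show "\<forall>\<^sub>F n in sequentially. L2_norm ?M (\<lambda>x. \<psi> (v x) - \<psi> (\<phi> n x)) \<le> B * L2_norm ?M (\<lambda>x. v x - \<phi> n x)"
      by simp
  qed (simp add: L2_norm_nonneg)
  have lim2: "(\<lambda>n. L2_norm ?M (\<lambda>x. H x - \<psi>' (\<phi> n x) *\<^sub>R grad (\<phi> n) x)) \<longlonglongrightarrow> 0"
  proof -
    \<comment> \<open>The error of the gradients is \<open>E n\<close> plus
      \<open>\<psi>' (\<phi> n x) *\<^sub>R (G x - grad (\<phi> n) x)\<close>. The second term is
      controlled by the bound \<open>B\<close>. The first tends to 0 by dominated convergence with
      \<open>2 * B * norm (G x)\<close>, since the almost everywhere limit of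
      \<open>\<phi> n\<close> and continuity of \<open>\<psi>'\<close> give pointwise
      convergence.\<close>
    define E where "E n x = (\<psi>' (v x) - \<psi>' (\<phi> n x)) *\<^sub>R G x" for n x
    have L2E: "E n \<in> L2 ?M" for n
      unfolding E_def
    proof (rule L2_dominated[OF vD(2), of _ "2 * B"])
      have "\<bar>\<psi>' (v x) - \<psi>' (\<phi> n x)\<bar> \<le> 2 * B" for x
        using bound[of "v x"] bound[of "\<phi> n x"] by linarith
      then show "AE x in ?M. norm ((\<psi>' (v x) - \<psi>' (\<phi> n x)) *\<^sub>R G x) \<le> 2 * B * norm (G x)"
        by (auto intro!: mult_right_mono)
    qed measurable
    have Elim: "(\<lambda>n. LINT x|?M. (norm (E n x))\<^sup>2) \<longlonglongrightarrow> (LINT x|?M. 0)"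
    proof (rule integral_dominated_convergence[where w="\<lambda>x. (2 * B)\<^sup>2 * (norm (G x))\<^sup>2"])
      show "(\<lambda>x. (norm (E n x))\<^sup>2) \<in> borel_measurable ?M" for n
        using L2_measurable[OF L2E] by measurable
      show "integrable ?M (\<lambda>x. (2 * B)\<^sup>2 * (norm (G x))\<^sup>2)"
        using L2_integrable[OF vD(2)] by simp
      show "AE x in ?M. (\<lambda>n. (norm (E n x))\<^sup>2) \<longlonglongrightarrow> 0"
        using r(2)
      proof eventually_elim
        case (elim x)
        have "isCont \<psi>' (v x)" using cont by (simp add: continuous_on_eq_continuous_at)
        then have "(\<lambda>n. \<psi>' (\<phi> n x)) \<longlonglongrightarrow> \<psi>' (v x)"
          using elim unfolding \<phi>_def by (rule isCont_tendsto_compose)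
        then have "(\<lambda>n. (norm (E n x))\<^sup>2) \<longlonglongrightarrow> (norm ((\<psi>' (v x) - \<psi>' (v x)) *\<^sub>R G x))\<^sup>2"
          unfolding E_def by (intro tendsto_intros)
        then show ?case by simp
      qed
      show "AE x in ?M. norm ((norm (E n x))\<^sup>2) \<le> (2 * B)\<^sup>2 * (norm (G x))\<^sup>2" for n
      proof (rule AE_I2)
        fix x
        have "\<bar>\<psi>' (v x) - \<psi>' (\<phi> n x)\<bar> \<le> 2 * B"
          using bound[of "v x"] bound[of "\<phi> n x"] by linarith
        then have "(norm (E n x))\<^sup>2 \<le> (2 * B * norm (G x))\<^sup>2"
          unfolding E_def by (intro power_mono) (auto intro!: mult_right_mono)
        then show "norm ((norm (E n x))\<^sup>2) \<le> (2 * B)\<^sup>2 * (norm (G x))\<^sup>2"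
          by (simp add: power_mult_distrib)
      qed
    qed simp
    have le: "(L2_norm ?M (\<lambda>x. H x - \<psi>' (\<phi> n x) *\<^sub>R grad (\<phi> n) x))\<^sup>2
        \<le> 2 * (LINT x|?M. (norm (E n x))\<^sup>2) + 2 * B\<^sup>2 * (L2_norm ?M (\<lambda>x. G x - grad (\<phi> n) x))\<^sup>2" for n
    proof -
      have dG: "(\<lambda>x. G x - grad (\<phi> n) x) \<in> L2 ?M" by (intro L2_diff vD L2\<phi>)
      have "(LINT x|?M. (norm (H x - \<psi>' (\<phi> n x) *\<^sub>R grad (\<phi> n) x))\<^sup>2)
          \<le> (LINT x|?M. 2 * (norm (E n x))\<^sup>2 + 2 * B\<^sup>2 * (norm (G x - grad (\<phi> n) x))\<^sup>2)"
      proof (rule integral_mono)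
        show "integrable ?M (\<lambda>x. (norm (H x - \<psi>' (\<phi> n x) *\<^sub>R grad (\<phi> n) x))\<^sup>2)"
          by (intro L2_integrable L2_diff L2H L2\<psi>\<phi>)
        show "integrable ?M (\<lambda>x. 2 * (norm (E n x))\<^sup>2 + 2 * B\<^sup>2 * (norm (G x - grad (\<phi> n) x))\<^sup>2)"
          using L2_integrable[OF L2E] L2_integrable[OF dG] by simp
        fix x
        have "H x - \<psi>' (\<phi> n x) *\<^sub>R grad (\<phi> n) x = E n x + \<psi>' (\<phi> n x) *\<^sub>R (G x - grad (\<phi> n) x)"
          by (simp add: H_def E_def algebra_simps)
        then have "norm (H x - \<psi>' (\<phi> n x) *\<^sub>R grad (\<phi> n) x) \<le> norm (E n x) + B * norm (G x - grad (\<phi> n) x)"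
          using bound[of "\<phi> n x"] by (auto intro!: norm_triangle_le add_left_mono mult_right_mono)
        then have "(norm (H x - \<psi>' (\<phi> n x) *\<^sub>R grad (\<phi> n) x))\<^sup>2 \<le> (norm (E n x) + B * norm (G x - grad (\<phi> n) x))\<^sup>2"
          by (intro power_mono) auto
        also have "\<dots> \<le> 2 * (norm (E n x))\<^sup>2 + 2 * (B * norm (G x - grad (\<phi> n) x))\<^sup>2"
          using sum_squares_bound[of "norm (E n x)" "B * norm (G x - grad (\<phi> n) x)"] by (simp add: power2_sum)
        finally show "(norm (H x - \<psi>' (\<phi> n x) *\<^sub>R grad (\<phi> n) x))\<^sup>2
            \<le> 2 * (norm (E n x))\<^sup>2 + 2 * B\<^sup>2 * (norm (G x - grad (\<phi> n) x))\<^sup>2"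
          by (simp add: power_mult_distrib)
      qed
      also have "\<dots> = 2 * (LINT x|?M. (norm (E n x))\<^sup>2) + 2 * B\<^sup>2 * (LINT x|?M. (norm (G x - grad (\<phi> n) x))\<^sup>2)"
        using L2_integrable[OF L2E] L2_integrable[OF dG] by simp
      finally show ?thesis by (simp add: L2_norm_power2)
    qed
    have "(\<lambda>n. 2 * (LINT x|?M. (norm (E n x))\<^sup>2) + 2 * B\<^sup>2 * (L2_norm ?M (\<lambda>x. G x - grad (\<phi> n) x))\<^sup>2)
        \<longlonglongrightarrow> 2 * (LINT x|?M. 0) + 2 * B\<^sup>2 * 0\<^sup>2"
      by (intro tendsto_intros Elim L2_lim)
    then have upper: "(\<lambda>n. 2 * (LINT x|?M. (norm (E n x))\<^sup>2) + 2 * B\<^sup>2 * (L2_norm ?M (\<lambda>x. G x - grad (\<phi> n) x))\<^sup>2)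
        \<longlonglongrightarrow> 0" by simp
    have "(\<lambda>n. (L2_norm ?M (\<lambda>x. H x - \<psi>' (\<phi> n x) *\<^sub>R grad (\<phi> n) x))\<^sup>2) \<longlonglongrightarrow> 0"
      by (rule tendsto_sandwich[OF _ _ tendsto_const upper]) (simp_all add: le)
    then have "(\<lambda>n. sqrt ((L2_norm ?M (\<lambda>x. H x - \<psi>' (\<phi> n x) *\<^sub>R grad (\<phi> n) x))\<^sup>2)) \<longlonglongrightarrow> sqrt 0"
      by (rule tendsto_real_sqrt)
    then show ?thesis by (simp add: L2_norm_nonneg)
  qed
  \<comment> \<open>Each smooth composition satisfies the identity by the classical chain rule, and
    both sides converge by \<open>lim1\<close> and \<open>lim2\<close>.\<close>
  have weak: "has_weak_grad \<Omega> (\<lambda>x. \<psi> (v x)) H"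
    unfolding has_weak_grad_def
  proof (intro conjI ballI L2\<psi>v L2H)
    fix \<eta> assume \<eta>: "\<eta> \<in> C1c \<Omega>"
    note L2\<eta> = C1c_L2[OF \<eta> leb]
    have lhs: "(\<lambda>n. LINT x|?M. \<psi> (\<phi> n x) *\<^sub>R grad \<eta> x) \<longlonglongrightarrow> (LINT x|?M. \<psi> (v x) *\<^sub>R grad \<eta> x)"
      by (rule L2_tendsto_integral_bilinear[OF bounded_bilinear_scaleR L2\<psi>v L2\<eta>(2) L2\<psi>\<phi>(1) lim1])
    have "(\<lambda>n. LINT x|?M. \<eta> x *\<^sub>R (\<psi>' (\<phi> n x) *\<^sub>R grad (\<phi> n) x)) \<longlonglongrightarrow> (LINT x|?M. \<eta> x *\<^sub>R H x)"
      by (rule L2_tendsto_integral_bilinear[OF bounded_bilinear.flip[OF bounded_bilinear_scaleR] L2H L2\<eta>(1) L2\<psi>\<phi>(2) lim2])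
    then have rhs: "(\<lambda>n. - (LINT x|?M. \<eta> x *\<^sub>R (\<psi>' (\<phi> n x) *\<^sub>R grad (\<phi> n) x))) \<longlonglongrightarrow> - (LINT x|?M. \<eta> x *\<^sub>R H x)"
      by (rule tendsto_minus)
    have "(LINT x|?M. \<psi> (\<phi> n x) *\<^sub>R grad \<eta> x) = - (LINT x|?M. \<eta> x *\<^sub>R (\<psi>' (\<phi> n x) *\<^sub>R grad (\<phi> n) x))" for n
      using has_weak_gradD(3)[OF C1c_has_weak_grad[OF \<Omega> \<psi>\<phi>(1)] \<eta>] by (simp only: \<psi>\<phi>(2))
    then show "(LINT x|?M. \<psi> (v x) *\<^sub>R grad \<eta> x) = - (LINT x|?M. \<eta> x *\<^sub>R H x)"
      by (intro LIMSEQ_unique[OF lhs]) (simp only: rhs)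
  qed
  have "has_weak_grad \<Omega> (\<lambda>x. \<psi> (v x) - \<psi> (\<phi> n x)) (\<lambda>x. H x - \<psi>' (\<phi> n x) *\<^sub>R grad (\<phi> n) x)" for n
    using has_weak_grad_diff[OF \<Omega> weak C1c_has_weak_grad[OF \<Omega> \<psi>\<phi>(1)]] by (simp only: \<psi>\<phi>(2))
  then have "(\<lambda>n. H1_norm \<Omega> (\<lambda>x. \<psi> (v x) - \<psi> (\<phi> n x))) \<longlonglongrightarrow> 0"
    using lim1 lim2 by (subst H1_norm_tendsto_zero_iff[OF \<Omega>]) auto
  moreover have "H = (\<lambda>x. \<psi>' (v x) *\<^sub>R weak_grad \<Omega> v x)"
    by (simp add: fun_eq_iff H_def G_def)
  ultimately show thesis
    using that \<phi> H1_lim weak by blast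
qed

text \<open>Linearity of \<open>T\<close>, valid almost everywhere, turns the difference of traces
  into the trace of the difference inside the norm; boundedness of \<open>T\<close> does the
  rest.\<close>

lemma L2_norm_trace_diff_tendsto:
  assumes T: "trace_operator \<Omega> T" and v: "v \<in> H1 \<Omega>" and w: "\<And>n. w n \<in> H1 \<Omega>" and \<Omega>: "open \<Omega>"
    and lim: "(\<lambda>n. H1_norm \<Omega> (\<lambda>x. v x - w n x)) \<longlonglongrightarrow> 0"
  shows "(\<lambda>n. L2_norm (surface_on (frontier \<Omega>)) (\<lambda>y. T v y - T (w n) y)) \<longlonglongrightarrow> 0"
proof -
  let ?S = "surface_on (frontier \<Omega>)"
  obtain C where C: "\<And>v. v \<in> H1 \<Omega> \<Longrightarrow> L2_norm ?S (T v) \<le> C * H1_norm \<Omega> v"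
    using T unfolding trace_operator_def by blast
  have L2T: "T v \<in> L2 ?S" if "v \<in> H1 \<Omega>" for v using T that by (simp add: trace_operator_def)
  have le: "L2_norm ?S (\<lambda>y. T v y - T (w n) y) \<le> C * H1_norm \<Omega> (\<lambda>x. v x - w n x)" for n
  proof -
    have d: "(\<lambda>x. v x - w n x) \<in> H1 \<Omega>"
      using has_weak_grad_diff[OF \<Omega>] has_weak_grad_weak_grad v w has_weak_grad_imp_H1 by metis
    have "\<forall>a b. AE y in ?S. T (\<lambda>x. a * v x + b * w n x) y = a * T v y + b * T (w n) y"
      using T v w unfolding trace_operator_def by blast
    from this[rule_format, of 1 "-1"]
    have "AE y in ?S. T (\<lambda>x. v x - w n x) y = T v y - T (w n) y" by simp
    then have "L2_norm ?S (T (\<lambda>x. v x - w n x)) = L2_norm ?S (\<lambda>y. T v y - T (w n) y)"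
      using L2T[OF d] L2T[OF v] L2T[OF w] by (intro L2_norm_cong_AE L2_measurable L2_diff)
    then show ?thesis using C[OF d] by simp
  qed
  show ?thesis
    by (rule tendsto_sandwich[OF _ _ tendsto_const tendsto_mult_right_zero[OF lim, of C]])
       (use le in \<open>auto simp: L2_norm_nonneg\<close>)
qed

text \<open>For smooth functions the trace is restriction and commutes with \<psi>. Both sides for
  \<open>v\<close> are almost everywhere limits of these smooth instances along a common
  subsequence, by continuity of \<open>T\<close> and of \<psi>.\<close>

lemma trace_compose:
  assumes \<Omega>: "open \<Omega>" and dense: "smooth_dense_in_H1 \<Omega>" and T: "trace_operator \<Omega> T" and v: "v \<in> H1 \<Omega>"
    and \<psi>: "\<And>s. (\<psi> has_real_derivative \<psi>' s) (at s)" and cont: "continuous_on UNIV \<psi>'"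
    and zero: "\<psi> 0 = 0" and bound: "\<And>s. \<bar>\<psi>' s\<bar> \<le> B"
  shows "AE y in surface_on (frontier \<Omega>). T (\<lambda>x. \<psi> (v x)) y = \<psi> (T v y)"
proof -
  let ?S = "surface_on (frontier \<Omega>)"
  obtain \<phi> where \<phi>: "\<And>n. \<phi> n \<in> C1c UNIV" "(\<lambda>n. H1_norm \<Omega> (\<lambda>x. v x - \<phi> n x)) \<longlonglongrightarrow> 0"
    and weak: "has_weak_grad \<Omega> (\<lambda>x. \<psi> (v x)) (\<lambda>x. \<psi>' (v x) *\<^sub>R weak_grad \<Omega> v x)"
    and \<psi>\<phi>_lim: "(\<lambda>n. H1_norm \<Omega> (\<lambda>x. \<psi> (v x) - \<psi> (\<phi> n x))) \<longlonglongrightarrow> 0"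
    by (rule H1_compose_approx[OF \<Omega> dense v \<psi> cont zero bound]) (rule that)
  have \<psi>\<phi>: "(\<lambda>x. \<psi> (\<phi> n x)) \<in> C1c UNIV" for n
    by (rule C1c_compose[OF \<phi>(1) \<psi> cont zero])
  have H1C: "\<phi> \<in> H1 \<Omega>" if "\<phi> \<in> C1c UNIV" for \<phi>
    using C1c_has_weak_grad[OF \<Omega> that] by (rule has_weak_grad_imp_H1)
  have \<psi>v: "(\<lambda>x. \<psi> (v x)) \<in> H1 \<Omega>" using weak by (rule has_weak_grad_imp_H1)
  have L2T: "T v \<in> L2 ?S" if "v \<in> H1 \<Omega>" for v using T that by (simp add: trace_operator_def)
  have TC: "AE y in ?S. T \<phi> y = \<phi> y" if "\<phi> \<in> C1c UNIV" for \<phi> using T that by (simp add: trace_operator_def)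
  have lim1: "(\<lambda>n. L2_norm ?S (\<lambda>y. T v y - T (\<phi> n) y)) \<longlonglongrightarrow> 0"
    by (rule L2_norm_trace_diff_tendsto[OF T v H1C[OF \<phi>(1)] \<Omega> \<phi>(2)])
  have lim2: "(\<lambda>n. L2_norm ?S (\<lambda>y. T (\<lambda>x. \<psi> (v x)) y - T (\<lambda>x. \<psi> (\<phi> n x)) y)) \<longlonglongrightarrow> 0"
    by (rule L2_norm_trace_diff_tendsto[OF T \<psi>v H1C[OF \<psi>\<phi>] \<Omega> \<psi>\<phi>_lim])
  obtain r :: "nat \<Rightarrow> nat" where r: "strict_mono r" "AE y in ?S. (\<lambda>n. T (\<phi> (r n)) y) \<longlonglongrightarrow> T v y"
    by (rule L2_tendsto_AE_subseq[OF L2T[OF v] L2T[OF H1C[OF \<phi>(1)]] lim1])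
  \<comment> \<open>The second subsequence is taken inside the first, so that both limits hold along
    \<open>r (s n)\<close>.\<close>
  have lim2': "(\<lambda>n. L2_norm ?S (\<lambda>y. T (\<lambda>x. \<psi> (v x)) y - T (\<lambda>x. \<psi> (\<phi> (r n) x)) y)) \<longlonglongrightarrow> 0"
    using LIMSEQ_subseq_LIMSEQ[OF lim2 r(1)] by (simp add: comp_def)
  obtain s :: "nat \<Rightarrow> nat" where s: "strict_mono s"
      "AE y in ?S. (\<lambda>n. T (\<lambda>x. \<psi> (\<phi> (r (s n)) x)) y) \<longlonglongrightarrow> T (\<lambda>x. \<psi> (v x)) y"
    by (rule L2_tendsto_AE_subseq[OF L2T[OF \<psi>v] L2T[OF H1C[OF \<psi>\<phi>]] lim2'])
  have "AE y in ?S. \<forall>n. T (\<phi> n) y = \<phi> n y \<and> T (\<lambda>x. \<psi> (\<phi> n x)) y = \<psi> (\<phi> n y)"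
    unfolding AE_all_countable using TC[OF \<phi>(1)] TC[OF \<psi>\<phi>] by auto
  with r(2) s(2) show ?thesis
  proof eventually_elim
    case (elim y)
    have "(\<lambda>n. T (\<phi> (r (s n))) y) \<longlonglongrightarrow> T v y"
      using LIMSEQ_subseq_LIMSEQ[OF elim(1) s(1)] by (simp add: comp_def)
    then have "(\<lambda>n. \<psi> (T (\<phi> (r (s n))) y)) \<longlonglongrightarrow> \<psi> (T v y)"
      by (rule isCont_tendsto_compose[OF DERIV_isCont[OF \<psi>]])
    then have "(\<lambda>n. T (\<lambda>x. \<psi> (\<phi> (r (s n)) x)) y) \<longlonglongrightarrow> \<psi> (T v y)"
      using elim(3) by simp
    with elim(2) show ?case by (rule LIMSEQ_unique)
  qed
qed

section \<open>Integrals of powers along a line\<close>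

lemma borel_measurable_power_int:
  fixes f :: "'a \<Rightarrow> real"
  assumes [measurable]: "f \<in> borel_measurable M"
  shows "(\<lambda>x. f x powi n) \<in> borel_measurable M"
proof (cases "0 \<le> n")
  case True
  then have "(\<lambda>x. f x powi n) = (\<lambda>x. f x ^ nat n)" by (simp add: power_int_def)
  then show ?thesis by simp
next
  case False
  then have "(\<lambda>x. f x powi n) = (\<lambda>x. inverse (f x) ^ nat (- n))" by (simp add: power_int_def)
  then show ?thesis by simp
qed

text \<open>Compactness of the interval from \<open>c\<close> to \<open>C\<close>, together with the
  dependence of |s powi n| on |s| alone, treats positive and negative values at once.\<close>

lemma power_int_bounded_annulus:
  fixes c C :: real
  assumes "0 < c"
  obtains B where "0 \<le> B" "\<And>s. c \<le> \<bar>s\<bar> \<Longrightarrow> \<bar>s\<bar> \<le> C \<Longrightarrow> \<bar>s powi n\<bar> \<le> B"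
proof -
  have "continuous_on {c..C} (\<lambda>s. s powi n)"
    using assms by (intro continuous_intros) auto
  then have "bounded ((\<lambda>s. s powi n) ` {c..C})"
    by (intro compact_imp_bounded compact_continuous_image) auto
  then obtain B where B: "0 < B" "\<And>s. s \<in> {c..C} \<Longrightarrow> \<bar>s powi n\<bar> \<le> B"
    by (auto simp: bounded_pos)
  have "\<bar>s powi n\<bar> = \<bar>\<bar>s\<bar> powi n\<bar>" for s :: real
    using norm_power_int[of s n] norm_power_int[of "\<bar>s\<bar>" n] by simp
  moreover have "\<bar>\<bar>s\<bar> powi n\<bar> \<le> B" if "c \<le> \<bar>s\<bar>" "\<bar>s\<bar> \<le> C" for s
    using B(2)[of "\<bar>s\<bar>"] that by simp
  ultimately show thesis using B(1) by (intro that[of B]) (simp_all only: less_imp_le)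
qed

lemma integrable_mult_bounded:
  fixes w f :: "'a \<Rightarrow> real"
  assumes w: "integrable M w" and f: "f \<in> borel_measurable M" and bound: "AE x in M. \<bar>f x\<bar> \<le> B"
  shows "integrable M (\<lambda>x. w x * f x)"
proof (rule Bochner_Integration.integrable_bound)
  show "integrable M (\<lambda>x. B * w x)" using w by simp
  show "(\<lambda>x. w x * f x) \<in> borel_measurable M" using w f by auto
  show "AE x in M. norm (w x * f x) \<le> norm (B * w x)"
    using bound
  proof eventually_elim
    case (elim x)
    then have "\<bar>w x\<bar> * \<bar>f x\<bar> \<le> \<bar>w x\<bar> * \<bar>B\<bar>" by (intro mult_left_mono) auto
    then show ?case by (simp add: abs_mult mult.commute)
  qed
qed

text \<open>For small \<open>t\<close> the values of \<open>u + t v\<close> stay in the region where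
  |s| lies between \<open>m / 2\<close> and \<open>K + m / 2\<close>, on which the power and its
  derivative are bounded. The mean value theorem then bounds the difference quotients uniformly in
  \<open>t\<close>, as dominated convergence requires.\<close>

lemma
  fixes w u v :: "'a \<Rightarrow> real" and n :: int
  assumes w: "integrable M w" and u: "u \<in> borel_measurable M" and v: "v \<in> borel_measurable M"
    and m: "0 < m" and ub: "AE x in M. m \<le> \<bar>u x\<bar> \<and> \<bar>u x\<bar> \<le> K" and vb: "AE x in M. \<bar>v x\<bar> \<le> B"
  shows integrable_power_int_line:
      "\<forall>\<^sub>F t in nhds 0. integrable M (\<lambda>x. w x * (u x + t * v x) powi n)"
    and integrable_power_int_line_deriv:
      "integrable M (\<lambda>x. w x * (of_int n * u x powi (n - 1) * v x))"
    and has_real_derivative_integral_power_int: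
      "((\<lambda>t. LINT x|M. w x * (u x + t * v x) powi n) has_real_derivative
        (LINT x|M. w x * (of_int n * u x powi (n - 1) * v x))) (at 0)"
proof -
  note [measurable] = u v borel_measurable_integrable[OF w] borel_measurable_power_int
  \<comment> \<open>Chosen so that |t v| \<le> m / 2, half the distance of \<open>u\<close> from 0;
    \<open>\<bar>B\<bar> + 1\<close> keeps the denominator positive for every
    \<open>B\<close>.\<close>
  define \<delta> where "\<delta> = m / (2 * (\<bar>B\<bar> + 1))"
  have \<delta>: "0 < \<delta>" using m by (simp add: \<delta>_def)
  obtain B0 where B0: "0 \<le> B0" "\<And>s. m / 2 \<le> \<bar>s\<bar> \<Longrightarrow> \<bar>s\<bar> \<le> K + m / 2 \<Longrightarrow> \<bar>s powi n\<bar> \<le> B0"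
    using power_int_bounded_annulus[of "m / 2" "K + m / 2" n] m by (metis half_gt_zero)
  obtain B1 where B1: "0 \<le> B1" "\<And>s. m / 2 \<le> \<bar>s\<bar> \<Longrightarrow> \<bar>s\<bar> \<le> K + m / 2 \<Longrightarrow> \<bar>s powi (n - 1)\<bar> \<le> B1"
    using power_int_bounded_annulus[of "m / 2" "K + m / 2" "n - 1"] m by (metis half_gt_zero)
  have small: "\<bar>t * v x\<bar> \<le> m / 2" if "\<bar>t\<bar> < \<delta>" "\<bar>v x\<bar> \<le> B" for t x
  proof -
    have "\<bar>t\<bar> * \<bar>v x\<bar> \<le> \<delta> * (\<bar>B\<bar> + 1)" using that \<delta> by (intro mult_mono) auto
    also have "\<dots> = m / 2" by (simp add: \<delta>_def field_simps add_nonneg_eq_0_iff)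
    finally show ?thesis by (simp add: abs_mult)
  qed
  have int_line: "integrable M (\<lambda>x. w x * (u x + t * v x) powi n)" if t: "\<bar>t\<bar> < \<delta>" for t
  proof (rule integrable_mult_bounded[OF w])
    show "AE x in M. \<bar>(u x + t * v x) powi n\<bar> \<le> B0"
      using ub vb
    proof eventually_elim
      case (elim x)
      then show ?case using small[OF t, of x] by (intro B0(2)) linarith+
    qed
  qed measurable
  then show "\<forall>\<^sub>F t in nhds 0. integrable M (\<lambda>x. w x * (u x + t * v x) powi n)"
    using \<delta> by (auto simp: eventually_nhds_metric dist_real_def)
  show "integrable M (\<lambda>x. w x * (of_int n * u x powi (n - 1) * v x))"
  proof (rule integrable_mult_bounded[OF w])
    show "AE x in M. \<bar>of_int n * u x powi (n - 1) * v x\<bar> \<le> \<bar>of_int n\<bar> * B1 * B"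
      using ub vb
    proof eventually_elim
      case (elim x)
      then have "\<bar>u x powi (n - 1)\<bar> \<le> B1" using m by (intro B1(2)) auto
      then show ?case using elim B1 unfolding abs_mult by (intro mult_mono) auto
    qed
  qed measurable
  let ?F = "\<lambda>t. LINT x|M. w x * (u x + t * v x) powi n"
  \<comment> \<open>Working within the interval makes every term of a test sequence admissible, not
    just almost all; openness removes the restriction afterwards.\<close>
  have "((\<lambda>t. (?F t - ?F 0) / t) \<longlongrightarrow> (LINT x|M. w x * (of_int n * u x powi (n - 1) * v x))) (at 0 within {-\<delta><..<\<delta>})"
    unfolding tendsto_at_iff_sequentially comp_def
  proof (intro allI impI)
    fix X :: "nat \<Rightarrow> real"
    assume X: "\<forall>i. X i \<in> {- \<delta><..<\<delta>} - {0}" "X \<longlonglongrightarrow> 0"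
    have X\<delta>: "\<bar>X i\<bar> < \<delta>" "X i \<noteq> 0" for i
      using X(1)[rule_format, of i] by auto
    have eq: "(?F (X i) - ?F 0) / X i
        = (LINT x|M. w x * (((u x + X i * v x) powi n - u x powi n) / X i))" for i
    proof -
      have "?F (X i) - ?F 0 = (LINT x|M. w x * (u x + X i * v x) powi n - w x * (u x + 0 * v x) powi n)"
        using int_line[OF X\<delta>(1)] int_line[of 0] \<delta> by (intro Bochner_Integration.integral_diff[symmetric]) auto
      then show ?thesis by (simp add: right_diff_distrib diff_divide_distrib flip: integral_divide_zero)
    qed
    show "(\<lambda>i. (?F (X i) - ?F 0) / X i) \<longlonglongrightarrow> (LINT x|M. w x * (of_int n * u x powi (n - 1) * v x))"
      unfolding eq
    proof (rule integral_dominated_convergence[where w="\<lambda>x. \<bar>w x\<bar> * (\<bar>of_int n\<bar> * B1 * \<bar>B\<bar>)"])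
      show "integrable M (\<lambda>x. \<bar>w x\<bar> * (\<bar>of_int n\<bar> * B1 * \<bar>B\<bar>))" using w by simp
      show "AE x in M. (\<lambda>i. w x * (((u x + X i * v x) powi n - u x powi n) / X i))
          \<longlonglongrightarrow> w x * (of_int n * u x powi (n - 1) * v x)"
        using ub
      proof eventually_elim
        case (elim x)
        then have "u x \<noteq> 0" using m by auto
        then have "((\<lambda>t. (u x + t * v x) powi n) has_real_derivative of_int n * u x powi (n - 1) * v x) (at 0)"
          by (auto intro!: derivative_eq_intros)
        then have "((\<lambda>t. ((u x + t * v x) powi n - u x powi n) / t) \<longlongrightarrow> of_int n * u x powi (n - 1) * v x) (at 0)"
          by (simp add: DERIV_def)
        moreover have "filterlim X (at 0) sequentially"
          using X by (auto simp: filterlim_at intro!: always_eventually)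
        ultimately have "(\<lambda>i. ((u x + X i * v x) powi n - u x powi n) / X i) \<longlonglongrightarrow> of_int n * u x powi (n - 1) * v x"
          by (rule filterlim_compose)
        then show ?case by (intro tendsto_intros)
      qed
      show "AE x in M. norm (w x * (((u x + X i * v x) powi n - u x powi n) / X i)) \<le> \<bar>w x\<bar> * (\<bar>of_int n\<bar> * B1 * \<bar>B\<bar>)" for i
        using ub vb
      proof eventually_elim
        case (elim x)
        \<comment> \<open>The mean value bound needs the whole segment, not only its endpoints, to
          avoid the singularity at 0.\<close>
        have seg: "m / 2 \<le> \<bar>s\<bar> \<and> \<bar>s\<bar> \<le> K + m / 2" if "s \<in> closed_segment (u x) (u x + X i * v x)" for s
          using segment_bound(1)[OF that] small[OF X\<delta>(1)[of i], of x] elim by auto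
        have "\<bar>(u x + X i * v x) powi n - u x powi n\<bar> \<le> (\<bar>of_int n\<bar> * B1) * \<bar>X i * v x\<bar>"
        proof -
          have "norm ((u x + X i * v x) powi n - u x powi n) \<le> (\<bar>of_int n\<bar> * B1) * norm (u x + X i * v x - u x)"
          proof (rule field_differentiable_bound[of "closed_segment (u x) (u x + X i * v x)"])
            fix s assume s: "s \<in> closed_segment (u x) (u x + X i * v x)"
            have "s \<noteq> 0" using seg[OF s] m by auto
            then show "((\<lambda>s. s powi n) has_field_derivative of_int n * s powi (n - 1))
                (at s within closed_segment (u x) (u x + X i * v x))"
              by (auto intro!: derivative_eq_intros)
            show "norm (of_int n * s powi (n - 1)) \<le> \<bar>of_int n\<bar> * B1"
              using B1(2)[of s] seg[OF s] unfolding norm_mult by (intro mult_mono) auto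
          qed auto
          then show ?thesis by simp
        qed
        then have "\<bar>((u x + X i * v x) powi n - u x powi n) / X i\<bar> \<le> \<bar>of_int n\<bar> * B1 * \<bar>v x\<bar>"
          using X\<delta>(2)[of i] by (simp add: abs_mult field_simps)
        also have "\<dots> \<le> \<bar>of_int n\<bar> * B1 * \<bar>B\<bar>"
          using elim B1 by (intro mult_left_mono) auto
        finally show ?case unfolding real_norm_def abs_mult[of "w x"] by (intro mult_left_mono) auto
      qed
    qed measurable
  qed
  then have "((\<lambda>t. (?F t - ?F 0) / t) \<longlongrightarrow> (LINT x|M. w x * (of_int n * u x powi (n - 1) * v x))) (at 0)"
    using \<delta> by (subst (asm) at_within_open) auto
  then show "(?F has_real_derivative (LINT x|M. w x * (of_int n * u x powi (n - 1) * v x))) (at 0)"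
    by (simp add: DERIV_def)
qed

section \<open>Weak form and energy\<close>

text \<open>The norm of a matrix is here the Euclidean norm of the norms of its rows, so
  Cauchy-Schwarz in each row suffices.\<close>

lemma norm_matrix_vector_mult_le:
  fixes A :: "real^'n^'m"
  shows "norm (A *v x) \<le> norm A * norm x"
proof -
  have "norm (A *v x) = L2_set (\<lambda>i. \<bar>A $ i \<bullet> x\<bar>) UNIV"
    by (simp add: norm_vec_def matrix_mult_dot)
  also have "\<dots> \<le> L2_set (\<lambda>i. norm (A $ i) * norm x) UNIV"
    by (intro L2_set_mono Cauchy_Schwarz_ineq2) auto
  also have "\<dots> = norm A * norm x"
    by (simp add: norm_vec_def L2_set_left_distrib)
  finally show ?thesis .
qed

lemma bounded_bilinear_matrix_vector_mult:
  "bounded_bilinear ((*v) :: real^'n^'m \<Rightarrow> real^'n \<Rightarrow> real^'m)"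
proof
  show "\<exists>K. \<forall>a b. norm ((a :: real^'n^'m) *v b) \<le> norm a * norm b * K"
    using norm_matrix_vector_mult_le by (intro exI[of _ 1]) auto
qed (auto simp: matrix_vector_mult_add_rdistrib matrix_vector_right_distrib matrix_vector_mult_scaleR scaleR_matrix_vector_assoc)

lemma sets_surface_measure: "sets surface_measure = sets borel"
  unfolding surface_measure_def by (metis sets.sets_measure_of_eq space_borel)

section \<open>Truncation by scaled arctan\<close>

lemma has_real_derivative_scaled_arctan:
  assumes "0 < k"
  shows "((\<lambda>s. k * arctan (s / k)) has_real_derivative inverse (1 + (s / k)\<^sup>2)) (at s)"
  using assms by (auto intro!: derivative_eq_intros)

lemma inverse_one_plus_square_bound: "\<bar>inverse (1 + (s::real)\<^sup>2)\<bar> \<le> 1"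
proof -
  have "1 \<le> 1 + s\<^sup>2" by simp
  then have "inverse (1 + s\<^sup>2) \<le> 1" by (rule inverse_le_1_iff[THEN iffD2, OF disjI2])
  then show ?thesis by simp
qed

text \<open>The first bound makes the untruncated function a dominating one; the second makes the
  truncated function an admissible bounded direction.\<close>

lemma scaled_arctan_bounds:
  assumes "0 < k"
  shows "\<bar>k * arctan (s / k)\<bar> \<le> \<bar>s\<bar>" "\<bar>k * arctan (s / k)\<bar> \<le> k * (pi / 2)"
proof -
  have "((\<lambda>s. k * arctan (s / k)) has_field_derivative inverse (1 + (t / k)\<^sup>2)) (at t within UNIV)" for t
    by (rule has_real_derivative_scaled_arctan[OF assms])
  moreover have "norm (inverse (1 + (t / k)\<^sup>2)) \<le> 1" for t
    unfolding real_norm_def by (rule inverse_one_plus_square_bound)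
  ultimately have "norm (k * arctan (s / k) - k * arctan (0 / k)) \<le> 1 * norm (s - 0)"
    using convex_UNIV by (intro field_differentiable_bound[where S=UNIV]) auto
  then show "\<bar>k * arctan (s / k)\<bar> \<le> \<bar>s\<bar>" by simp
  have "\<bar>arctan (s / k)\<bar> \<le> pi / 2"
    using arctan_bounded[of "s / k"] by auto
  then show "\<bar>k * arctan (s / k)\<bar> \<le> k * (pi / 2)"
    using assms by (simp add: abs_mult mult_left_mono)
qed

text \<open>For \<open>s \<noteq> 0\<close> this is \<open>s\<close> times the difference quotient
  of arctan at 0 with increment \<open>s / real (Suc n)\<close>, and arctan has derivative 1 at
  0.\<close>

lemma scaled_arctan_tendsto:
  "(\<lambda>n. real (Suc n) * arctan (s / real (Suc n))) \<longlonglongrightarrow> s"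
proof -
  have "((\<lambda>h. arctan h / h) \<longlongrightarrow> 1) (at 0)"
    using DERIV_arctan[of 0] by (simp add: DERIV_def)
  show ?thesis
  proof (cases "s = 0")
    case False
    have "filterlim (\<lambda>n. s / real (Suc n)) (at 0) sequentially"
      using False LIMSEQ_Suc[OF lim_const_over_n[of s]]
      by (auto simp: filterlim_at simp del: of_nat_Suc intro!: always_eventually)
    with \<open>((\<lambda>h. arctan h / h) \<longlongrightarrow> 1) (at 0)\<close>
    have "(\<lambda>n. arctan (s / real (Suc n)) / (s / real (Suc n))) \<longlonglongrightarrow> 1"
      by (rule filterlim_compose)
    then have "(\<lambda>n. s * (arctan (s / real (Suc n)) / (s / real (Suc n)))) \<longlonglongrightarrow> s * 1"
      by (intro tendsto_intros)
    then show ?thesis using False by (simp add: mult.commute)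
  qed simp
qed

lemma inverse_one_plus_square_tendsto:
  "(\<lambda>n. inverse (1 + (s / real (Suc n))\<^sup>2)) \<longlonglongrightarrow> 1"
proof -
  have "(\<lambda>n. inverse (1 + (s / real (Suc n))\<^sup>2)) \<longlonglongrightarrow> inverse (1 + 0\<^sup>2)"
    by (intro tendsto_intros LIMSEQ_Suc[OF lim_const_over_n]) auto
  then show ?thesis by simp
qed

text \<open>The bounds on \<open>a\<close>, \<open>c\<close> and \<open>R\<close> are fixed as
  parameters so that the estimates can name them.\<close>

locale hamiltonian_constraint =
  fixes \<Omega> D N :: "(real^3) set"
    and T :: "(real^3 \<Rightarrow> real) \<Rightarrow> real^3 \<Rightarrow> real"
    and a :: "real^3 \<Rightarrow> real^3^3"
    and R \<tau>2 \<sigma>2 \<rho> c g\<^sub>N u :: "real^3 \<Rightarrow> real"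
    and lo hi Ba Bc BR :: real
  assumes \<Omega>: "open \<Omega>" and dense: "smooth_dense_in_H1 \<Omega>" and T: "trace_operator \<Omega> T"
    and D: "D \<in> sets borel" "D \<subseteq> frontier \<Omega>" and N: "N \<in> sets borel" "N \<subseteq> frontier \<Omega>"
    and a_measurable: "a \<in> borel_measurable (lebesgue_on \<Omega>)"
    and a_bound: "AE x in lebesgue_on \<Omega>. norm (a x) \<le> Ba"
    and a_sym: "AE x in lebesgue_on \<Omega>. transpose (a x) = a x"
    and c_measurable: "c \<in> borel_measurable (surface_on N)"
    and c_bound: "AE y in surface_on N. \<bar>c y\<bar> \<le> Bc"
    and g_L2: "g\<^sub>N \<in> L2 (surface_on N)"
    and R_measurable: "R \<in> borel_measurable (lebesgue_on \<Omega>)"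
    and R_bound: "AE x in lebesgue_on \<Omega>. \<bar>R x\<bar> \<le> BR"
    and coeff_L2: "\<tau>2 \<in> L2 (lebesgue_on \<Omega>)" "\<sigma>2 \<in> L2 (lebesgue_on \<Omega>)" "\<rho> \<in> L2 (lebesgue_on \<Omega>)"
    and sign: "0 < lo \<or> hi < 0"
    and u_H1: "u \<in> H1 \<Omega>" and u_interval: "u \<in> order_interval \<Omega> lo hi"
begin

abbreviation "M \<equiv> lebesgue_on \<Omega>"
abbreviation "S \<equiv> surface_on N"

text \<open>The distance of the interval from 0 when it lies on one side of 0. With
  \<open>upper\<close> it encloses |u|, so the positive and the negative case need no separate
  treatment.\<close>

definition lower :: real where "lower = (if 0 < lo then lo else - hi)"
definition upper :: real where "upper = \<bar>lo\<bar> + \<bar>hi\<bar>"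

lemma lower_pos: "0 < lower"
  using sign by (auto simp: lower_def)

lemma u_bounds: "AE x in M. lower \<le> \<bar>u x\<bar> \<and> \<bar>u x\<bar> \<le> upper"
  using u_interval unfolding order_interval_def mem_Collect_eq
  by eventually_elim (use sign in \<open>auto simp: lower_def upper_def\<close>)

lemmas u_L2 = H1_L2(1)[OF u_H1] and grad_u_L2 = H1_L2(2)[OF u_H1]

text \<open>Square integrability of a function bounded away from zero forces \<open>\<Omega>\<close> to have finite measure.\<close>

lemma one_L2: "(\<lambda>_. 1 :: real) \<in> L2 M"
proof (rule L2_dominated[OF u_L2, of _ "1 / lower"])
  show "AE x in M. norm (1 :: real) \<le> 1 / lower * norm (u x)"
    using u_bounds by eventually_elim (use lower_pos in \<open>simp add: field_simps\<close>)
qed simp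

text \<open>The constant 1 is itself square integrable, so a square integrable function is
  integrable as a product with 1.\<close>

lemma L2_imp_integrable:
  fixes f :: "real^3 \<Rightarrow> real"
  assumes "f \<in> L2 M"
  shows "integrable M f"
  using L2_integrable_bilinear[OF bounded_bilinear_mult one_L2 assms] by simp

lemma R_L2: "R \<in> L2 M"
  using L2_mult_bounded[OF one_L2 R_measurable R_bound] by simp

lemma a_mult_L2:
  assumes "G \<in> L2 M"
  shows "(\<lambda>x. a x *v G x) \<in> L2 M"
proof (rule L2_dominated[OF assms, of _ Ba])
  show "(\<lambda>x. a x *v G x) \<in> borel_measurable M"
    by (rule borel_measurable_continuous_Pair[OF a_measurable L2_measurable[OF assms]])
       (intro bounded_bilinear.continuous_on[OF bounded_bilinear_matrix_vector_mult] continuous_intros)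
  show "AE x in M. norm (a x *v G x) \<le> Ba * norm (G x)"
    using a_bound
    by eventually_elim (meson norm_matrix_vector_mult_le mult_right_mono norm_ge_zero order_trans)
qed

lemma frontier_borel: "frontier \<Omega> \<in> sets surface_measure"
  by (simp add: sets_surface_measure)

lemma trace_L2:
  assumes "v \<in> H1 \<Omega>"
  shows "T v \<in> L2 S"
  by (rule L2_restrict_space_mono[OF _ N(2) frontier_borel])
     (use T N assms in \<open>auto simp: sets_surface_measure trace_operator_def\<close>)

section \<open>Weak gradients and traces along the line through \<open>u\<close>\<close>

lemma u_line_H1: "v \<in> H1 \<Omega> \<Longrightarrow> (\<lambda>x. u x + t * v x) \<in> H1 \<Omega>"
  using has_weak_grad_lincomb[OF \<Omega> u_H1[THEN has_weak_grad_weak_grad], of v _ 1 t] has_weak_grad_weak_grad[of v]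
  by (auto intro: has_weak_grad_imp_H1)

lemma weak_grad_line:
  assumes "v \<in> H1 \<Omega>"
  shows "AE x in M. weak_grad \<Omega> (\<lambda>x. u x + t * v x) x = weak_grad \<Omega> u x + t *\<^sub>R weak_grad \<Omega> v x"
  using weak_grad_AE_eq[OF \<Omega> has_weak_grad_lincomb[OF \<Omega> u_H1[THEN has_weak_grad_weak_grad]
    has_weak_grad_weak_grad[OF assms], of 1 t]] by simp

lemma trace_line:
  assumes "v \<in> H1 \<Omega>"
  shows "AE y in S. T (\<lambda>x. u x + t * v x) y = T u y + t * T v y"
proof (rule AE_restrict_space_mono[OF _ N(2) frontier_borel])
  have "\<forall>a b. AE y in surface_on (frontier \<Omega>). T (\<lambda>x. a * u x + b * v x) y = a * T u y + b * T v y"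
    using T assms u_H1 unfolding trace_operator_def by blast
  from this[rule_format, of 1 t]
  show "AE y in surface_on (frontier \<Omega>). T (\<lambda>x. u x + t * v x) y = T u y + t * T v y" by simp
qed (use N in \<open>simp add: sets_surface_measure\<close>)

text \<open>The derivative in \<open>u\<close> of the part of the energy density that contains no
  gradient.\<close>

definition nonlinearity :: "real^3 \<Rightarrow> real" where
  "nonlinearity x = R x / 8 * u x + \<tau>2 x / 12 * u x ^ 5 - \<sigma>2 x / 8 * u x powi (-7)
     - 2 * pi * \<rho> x * u x powi (-3)"

text \<open>Kept as a functional of \<open>v\<close>, because it is both the candidate for the
  derivative of the energy and the quantity passed to the limit under truncation.\<close>

definition weak_form :: "(real^3 \<Rightarrow> real) \<Rightarrow> real" where
  "weak_form v = (LINT x|M. (a x *v weak_grad \<Omega> u x) \<bullet> weak_grad \<Omega> v x + nonlinearity x * v x)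
     + (LINT y|S. (c y * T u y - g\<^sub>N y) * T v y)"

lemma weak_solution_iff:
  "weak_solution \<Omega> D N T a R \<tau>2 \<sigma>2 \<rho> c g\<^sub>N u \<longleftrightarrow> (\<forall>v\<in>H1_0 \<Omega> D T. weak_form v = 0)"
  by (simp add: weak_solution_def weak_form_def nonlinearity_def)

lemma power_u_mult_L2:
  assumes "w \<in> L2 M"
  shows "(\<lambda>x. w x * u x powi n) \<in> L2 M"
proof -
  obtain B where B: "\<And>s. lower \<le> \<bar>s\<bar> \<Longrightarrow> \<bar>s\<bar> \<le> upper \<Longrightarrow> \<bar>s powi n\<bar> \<le> B"
    using power_int_bounded_annulus[OF lower_pos] by metis
  show ?thesis
  proof (rule L2_mult_bounded[OF assms])
    show "(\<lambda>x. u x powi n) \<in> borel_measurable M"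
      by (rule borel_measurable_power_int[OF L2_measurable[OF u_L2]])
    show "AE x in M. \<bar>u x powi n\<bar> \<le> B"
      using u_bounds by eventually_elim (use B in auto)
  qed
qed

lemma nonlinearity_L2: "nonlinearity \<in> L2 M"
proof -
  \<comment> \<open>The nesting with weights 1 brings the sum into the two-term shape of
    \<open>L2_lincomb\<close>, and every power is written with \<open>powi\<close> to fit
    \<open>power_u_mult_L2\<close>.\<close>
  have "(\<lambda>x. 1 *\<^sub>R (1 *\<^sub>R ((1/8) *\<^sub>R (R x * u x powi 1) + (1/12) *\<^sub>R (\<tau>2 x * u x powi 5))
      + (-1/8) *\<^sub>R (\<sigma>2 x * u x powi (-7))) + (- 2 * pi) *\<^sub>R (\<rho> x * u x powi (-3))) \<in> L2 M"
    by (intro L2_lincomb power_u_mult_L2 R_L2 coeff_L2)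
  also have "(\<lambda>x. 1 *\<^sub>R (1 *\<^sub>R ((1/8) *\<^sub>R (R x * u x powi 1) + (1/12) *\<^sub>R (\<tau>2 x * u x powi 5))
      + (-1/8) *\<^sub>R (\<sigma>2 x * u x powi (-7))) + (- 2 * pi) *\<^sub>R (\<rho> x * u x powi (-3))) = nonlinearity"
    by (auto simp: fun_eq_iff nonlinearity_def)
  finally show ?thesis .
qed

lemma flux_L2: "(\<lambda>y. c y * T u y - g\<^sub>N y) \<in> L2 S"
  using L2_diff[OF L2_mult_bounded[OF trace_L2[OF u_H1] c_measurable c_bound] g_L2]
  by (simp add: mult.commute)

text \<open>Near \<open>t = 0\<close> the energy along the line is a quadratic polynomial in
  \<open>t\<close>, from the gradient and boundary terms, plus four power integrals whose
  derivatives are known.\<close>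

lemma energy_has_real_derivative:
  assumes v: "v \<in> H1 \<Omega>" and vb: "AE x in M. \<bar>v x\<bar> \<le> B"
  shows "((\<lambda>t. energy \<Omega> N T a R \<tau>2 \<sigma>2 \<rho> c g\<^sub>N (\<lambda>x. u x + t * v x)) has_real_derivative weak_form v) (at 0)"
proof -
  note v_L2 = H1_L2(1)[OF v] and grad_v_L2 = H1_L2(2)[OF v]
  note Tu = trace_L2[OF u_H1] and Tv = trace_L2[OF v]
  let ?Gu = "weak_grad \<Omega> u" and ?Gv = "weak_grad \<Omega> v"
  define F where "F w n t = (LINT x|M. w x * (u x + t * v x) powi n)" for w :: "real^3 \<Rightarrow> real" and n t
  define F' where "F' w n = (LINT x|M. w x * (of_int n * u x powi (n - 1) * v x))" for w :: "real^3 \<Rightarrow> real" and n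
  note line = L2_measurable[OF u_L2] L2_measurable[OF v_L2] lower_pos u_bounds vb
  note int_line = integrable_power_int_line[OF L2_imp_integrable line]
  note int_deriv = integrable_power_int_line_deriv[OF L2_imp_integrable line]
  have F_deriv [derivative_intros]: "(F w n has_real_derivative F' w n) (at 0)" if "w \<in> L2 M" for w n
    unfolding F_def[abs_def] F'_def by (rule has_real_derivative_integral_power_int[OF L2_imp_integrable[OF that] line])
  note int_inner = L2_integrable_bilinear[OF bounded_bilinear_inner a_mult_L2]
  note int_mult = L2_integrable_bilinear[OF bounded_bilinear_mult]
  have c_L2: "(\<lambda>y. c y * f y) \<in> L2 S" if "f \<in> L2 S" for f
    using L2_mult_bounded[OF that c_measurable c_bound] by (simp add: mult.commute)
  define A0 where "A0 = (LINT x|M. (a x *v ?Gu x) \<bullet> ?Gu x)"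
  define A1 where "A1 = (LINT x|M. (a x *v ?Gu x) \<bullet> ?Gv x)"
  define A2 where "A2 = (LINT x|M. (a x *v ?Gv x) \<bullet> ?Gv x)"
  define C0 where "C0 = (LINT y|S. c y * T u y * T u y)"
  define C1 where "C1 = (LINT y|S. c y * T u y * T v y)"
  define C2 where "C2 = (LINT y|S. c y * T v y * T v y)"
  define G0 where "G0 = (LINT y|S. g\<^sub>N y * T u y)"
  define G1 where "G1 = (LINT y|S. g\<^sub>N y * T v y)"
  define P where "P t = 1/2 * A0 + t * A1 + t\<^sup>2 / 2 * A2
      + 1/16 * F R 2 t + 1/72 * F \<tau>2 6 t + 1/48 * F \<sigma>2 (-6) t + pi * F \<rho> (-2) t
      + 1/2 * (C0 + 2 * t * C1 + t\<^sup>2 * C2) - (G0 + t * G1)" for t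
  \<comment> \<open>Splitting the energy integral into a sum requires each power integral to be
    integrable, which is known for small \<open>t\<close>; a neighbourhood of 0 is enough for the
    derivative.\<close>
  have ev: "\<forall>\<^sub>F t in nhds 0. energy \<Omega> N T a R \<tau>2 \<sigma>2 \<rho> c g\<^sub>N (\<lambda>x. u x + t * v x) = P t"
    using int_line[OF R_L2, of 2] int_line[OF coeff_L2(1), of 6] int_line[OF coeff_L2(2), of "-6"]
      int_line[OF coeff_L2(3), of "-2"]
  proof eventually_elim
    case (elim t)
    let ?w = "\<lambda>x. u x + t * v x"
    have w: "?w \<in> H1 \<Omega>" by (rule u_line_H1[OF v])
    note wm = H1_L2[OF w, THEN L2_measurable]
    note meas = L2_measurable[OF R_L2] coeff_L2[THEN L2_measurable] wm
      borel_measurable_power_int[OF wm(1)]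
    let ?Q = "\<lambda>x. 1/2 * ((a x *v ?Gu x) \<bullet> ?Gu x) + t * ((a x *v ?Gu x) \<bullet> ?Gv x) + t\<^sup>2 / 2 * ((a x *v ?Gv x) \<bullet> ?Gv x)
        + 1/16 * (R x * ?w x powi 2) + 1/72 * (\<tau>2 x * ?w x powi 6) + 1/48 * (\<sigma>2 x * ?w x powi (-6))
        + pi * (\<rho> x * ?w x powi (-2))"
    have "(LINT x|M. 1/2 * ((a x *v weak_grad \<Omega> ?w x) \<bullet> weak_grad \<Omega> ?w x)
        + 1/16 * R x * (?w x)\<^sup>2 + 1/72 * \<tau>2 x * ?w x ^ 6 + 1/48 * \<sigma>2 x * ?w x powi (-6)
        + pi * \<rho> x * ?w x powi (-2)) = (LINT x|M. ?Q x)"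
    proof (rule integral_cong_AE)
      have [measurable]: "(\<lambda>x. (a x *v weak_grad \<Omega> ?w x) \<bullet> weak_grad \<Omega> ?w x) \<in> borel_measurable M"
        by (rule borel_measurable_integrable[OF int_inner[OF H1_L2(2)[OF w] H1_L2(2)[OF w]]])
      note [measurable] = meas
      show "(\<lambda>x. 1/2 * ((a x *v weak_grad \<Omega> ?w x) \<bullet> weak_grad \<Omega> ?w x)
        + 1/16 * R x * (?w x)\<^sup>2 + 1/72 * \<tau>2 x * ?w x ^ 6 + 1/48 * \<sigma>2 x * ?w x powi (-6)
        + pi * \<rho> x * ?w x powi (-2)) \<in> borel_measurable M" by measurable
      show "?Q \<in> borel_measurable M"
        using int_inner[OF grad_u_L2 grad_u_L2] int_inner[OF grad_u_L2 grad_v_L2] int_inner[OF grad_v_L2 grad_v_L2]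
        by (intro borel_measurable_add borel_measurable_times borel_measurable_const meas) auto
      show "AE x in M. 1/2 * ((a x *v weak_grad \<Omega> ?w x) \<bullet> weak_grad \<Omega> ?w x)
        + 1/16 * R x * (?w x)\<^sup>2 + 1/72 * \<tau>2 x * ?w x ^ 6 + 1/48 * \<sigma>2 x * ?w x powi (-6)
        + pi * \<rho> x * ?w x powi (-2) = ?Q x"
        using weak_grad_line[OF v, of t] a_sym
      proof eventually_elim
        case (elim x)
        \<comment> \<open>Symmetry of \<open>a\<close> merges the two cross terms; the factor 1/2 in
          the energy then leaves exactly the bilinear form of the weak equation.\<close>
        have "(a x *v ?Gv x) \<bullet> ?Gu x = (a x *v ?Gu x) \<bullet> ?Gv x"
          by (metis elim(2) dot_lmul_matrix inner_commute transpose_matrix_vector)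
        then have "(a x *v (?Gu x + t *\<^sub>R ?Gv x)) \<bullet> (?Gu x + t *\<^sub>R ?Gv x)
            = (a x *v ?Gu x) \<bullet> ?Gu x + 2 * t * ((a x *v ?Gu x) \<bullet> ?Gv x) + t\<^sup>2 * ((a x *v ?Gv x) \<bullet> ?Gv x)"
          by (simp add: matrix_vector_right_distrib matrix_vector_mult_scaleR inner_add_left inner_add_right
            power2_eq_square algebra_simps)
        then show ?case unfolding elim(1) by (simp add: field_simps)
      qed
    qed
    also have "\<dots> = 1/2 * A0 + t * A1 + t\<^sup>2 / 2 * A2
      + 1/16 * F R 2 t + 1/72 * F \<tau>2 6 t + 1/48 * F \<sigma>2 (-6) t + pi * F \<rho> (-2) t"
      unfolding A0_def A1_def A2_def F_def
      using int_inner[OF grad_u_L2 grad_u_L2] int_inner[OF grad_u_L2 grad_v_L2] int_inner[OF grad_v_L2 grad_v_L2] elim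
      by (simp del: power_int_numeral)
    finally have bulk: "(LINT x|M. 1/2 * ((a x *v weak_grad \<Omega> ?w x) \<bullet> weak_grad \<Omega> ?w x)
        + 1/16 * R x * (?w x)\<^sup>2 + 1/72 * \<tau>2 x * ?w x ^ 6 + 1/48 * \<sigma>2 x * ?w x powi (-6)
        + pi * \<rho> x * ?w x powi (-2)) = 1/2 * A0 + t * A1 + t\<^sup>2 / 2 * A2
      + 1/16 * F R 2 t + 1/72 * F \<tau>2 6 t + 1/48 * F \<sigma>2 (-6) t + pi * F \<rho> (-2) t" .
    note [measurable] = L2_measurable[OF trace_L2[OF w]] L2_measurable[OF Tu] L2_measurable[OF Tv]
      L2_measurable[OF g_L2] c_measurable
    have "(LINT y|S. c y * (T ?w y)\<^sup>2)
        = (LINT y|S. c y * T u y * T u y + 2 * t * (c y * T u y * T v y) + t\<^sup>2 * (c y * T v y * T v y))"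
    proof (rule integral_cong_AE)
      show "AE y in S. c y * (T ?w y)\<^sup>2
          = c y * T u y * T u y + 2 * t * (c y * T u y * T v y) + t\<^sup>2 * (c y * T v y * T v y)"
        using trace_line[OF v, of t] by eventually_elim (simp add: power2_eq_square algebra_simps)
    qed measurable
    also have "\<dots> = C0 + 2 * t * C1 + t\<^sup>2 * C2"
      unfolding C0_def C1_def C2_def
      using int_mult[OF c_L2[OF Tu] Tu] int_mult[OF c_L2[OF Tu] Tv] int_mult[OF c_L2[OF Tv] Tv] by simp
    finally have robin: "(LINT y|S. c y * (T ?w y)\<^sup>2) = C0 + 2 * t * C1 + t\<^sup>2 * C2" .
    have "(LINT y|S. g\<^sub>N y * T ?w y) = (LINT y|S. g\<^sub>N y * T u y + t * (g\<^sub>N y * T v y))"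
    proof (rule integral_cong_AE)
      show "AE y in S. g\<^sub>N y * T ?w y = g\<^sub>N y * T u y + t * (g\<^sub>N y * T v y)"
        using trace_line[OF v, of t] by eventually_elim (simp add: algebra_simps)
    qed measurable
    also have "\<dots> = G0 + t * G1"
      unfolding G0_def G1_def using int_mult[OF g_L2 Tu] int_mult[OF g_L2 Tv] by simp
    finally have neumann: "(LINT y|S. g\<^sub>N y * T ?w y) = G0 + t * G1" .
    show ?case
      unfolding energy_def bulk robin neumann P_def by simp
  qed
  have "(P has_real_derivative A1 + 1/16 * F' R 2 + 1/72 * F' \<tau>2 6 + 1/48 * F' \<sigma>2 (-6) + pi * F' \<rho> (-2)
      + C1 - G1) (at 0)"
    unfolding P_def[abs_def] by (auto intro!: derivative_eq_intros R_L2 coeff_L2)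
  also have "A1 + 1/16 * F' R 2 + 1/72 * F' \<tau>2 6 + 1/48 * F' \<sigma>2 (-6) + pi * F' \<rho> (-2) + C1 - G1 = weak_form v"
  proof -
    let ?f = "\<lambda>w n x. w x * (of_int n * u x powi (n - 1) * v x)"
    \<comment> \<open>The exponents meet the energy weights: 2/16 = 1/8, 6/72 = 1/12, -6/48 = -1/8,
      and \<open>pi\<close> times -2.\<close>
    have "(LINT x|M. (a x *v ?Gu x) \<bullet> ?Gv x + nonlinearity x * v x)
        = (LINT x|M. (a x *v ?Gu x) \<bullet> ?Gv x + 1/16 * ?f R 2 x + 1/72 * ?f \<tau>2 6 x
          + 1/48 * ?f \<sigma>2 (-6) x + pi * ?f \<rho> (-2) x)"
      by (intro Bochner_Integration.integral_cong) (auto simp: nonlinearity_def field_simps)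
    also have "\<dots> = A1 + 1/16 * F' R 2 + 1/72 * F' \<tau>2 6 + 1/48 * F' \<sigma>2 (-6) + pi * F' \<rho> (-2)"
      unfolding A1_def F'_def
      using int_inner[OF grad_u_L2 grad_v_L2] int_deriv[OF R_L2, of 2] int_deriv[OF coeff_L2(1), of 6]
        int_deriv[OF coeff_L2(2), of "-6"] int_deriv[OF coeff_L2(3), of "-2"]
      by (simp del: power_int_numeral of_int_numeral of_int_minus of_int_neg_numeral)
    finally have bulk: "(LINT x|M. (a x *v ?Gu x) \<bullet> ?Gv x + nonlinearity x * v x)
        = A1 + 1/16 * F' R 2 + 1/72 * F' \<tau>2 6 + 1/48 * F' \<sigma>2 (-6) + pi * F' \<rho> (-2)" .
    have "(LINT y|S. (c y * T u y - g\<^sub>N y) * T v y) = C1 - G1"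
      unfolding C1_def G1_def left_diff_distrib
      using int_mult[OF c_L2[OF Tu] Tv] int_mult[OF g_L2 Tv] by simp
    with bulk show ?thesis by (simp add: weak_form_def)
  qed
  finally show ?thesis using DERIV_cong_ev[OF refl ev refl] by simp
qed

text \<open>A single \<open>t > 0\<close> suffices: \<open>u + t v\<close> and \<open>u\<close> are
  both bounded, hence so is their difference divided by \<open>t\<close>.\<close>

lemma u_line_in_domain_imp_bounded:
  assumes "\<forall>\<^sub>F t in nhds 0. (\<lambda>x. u x + t * v x) \<in> energy_domain \<Omega>"
  obtains B where "AE x in M. \<bar>v x\<bar> \<le> B"
proof -
  obtain d where d: "0 < d" "\<And>t. \<bar>t\<bar> < d \<Longrightarrow> (\<lambda>x. u x + t * v x) \<in> energy_domain \<Omega>"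
    using assms by (auto simp: eventually_nhds_metric dist_real_def)
  define t where "t = d / 2"
  have t: "0 < t" "\<bar>t\<bar> < d" using d(1) by (auto simp: t_def)
  obtain l h where "AE x in M. l \<le> u x + t * v x \<and> u x + t * v x \<le> h"
    using d(2)[OF t(2)] by (auto simp: energy_domain_def order_interval_def)
  then have "AE x in M. \<bar>v x\<bar> \<le> (\<bar>l\<bar> + \<bar>h\<bar> + upper) / t"
    using u_bounds
  proof eventually_elim
    case (elim x)
    then have "\<bar>t * v x\<bar> \<le> \<bar>l\<bar> + \<bar>h\<bar> + upper" by linarith
    then show ?case using t(1) by (simp add: abs_mult field_simps)
  qed
  then show thesis by (rule that)
qed

text \<open>Widening the interval of \<open>u\<close> by \<open>lower / 2\<close> at both ends
  leaves it on the same side of 0 and makes room for \<open>t v\<close>.\<close>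

lemma bounded_imp_u_line_in_domain:
  assumes v: "v \<in> H1 \<Omega>" and vb: "AE x in M. \<bar>v x\<bar> \<le> B"
  shows "\<forall>\<^sub>F t in nhds 0. (\<lambda>x. u x + t * v x) \<in> energy_domain \<Omega>"
proof -
  define d where "d = lower / (2 * (\<bar>B\<bar> + 1))"
  have d: "0 < d" using lower_pos by (simp add: d_def)
  have "(\<lambda>x. u x + t * v x) \<in> energy_domain \<Omega>" if t: "\<bar>t\<bar> < d" for t
  proof -
    have "AE x in M. lo - lower / 2 \<le> u x + t * v x \<and> u x + t * v x \<le> hi + lower / 2"
      using vb u_interval[unfolded order_interval_def mem_Collect_eq]
    proof eventually_elim
      case (elim x)
      have "\<bar>t\<bar> * \<bar>v x\<bar> \<le> d * (\<bar>B\<bar> + 1)" using t d elim by (intro mult_mono) auto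
      also have "\<dots> = lower / 2" by (simp add: d_def field_simps add_nonneg_eq_0_iff)
      finally have "\<bar>t * v x\<bar> \<le> lower / 2" by (simp add: abs_mult)
      with elim show ?case by linarith
    qed
    moreover have "0 < lo - lower / 2 \<or> hi + lower / 2 < 0"
      using sign by (auto simp: lower_def)
    ultimately show ?thesis
      unfolding energy_domain_def order_interval_def mem_Collect_eq
      by (intro conjI u_line_H1[OF v] exI)
  qed
  then show ?thesis using d by (auto simp: eventually_nhds_metric dist_real_def)
qed

text \<open>The profile vanishes at 0, so the chain rule for traces preserves the condition on
  \<open>D\<close>. Weak gradient and trace of \<open>V n\<close> are in norm at most those of
  \<open>v\<close>, and |V n| \<le> |v|, so bulk and boundary integrals converge by
  domination.\<close>

lemma bounded_H1_0_approx:
  assumes v: "v \<in> H1_0 \<Omega> D T"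
  obtains V where "\<And>n. V n \<in> H1_0 \<Omega> D T" "\<And>n x. \<bar>V n x\<bar> \<le> real (Suc n) * (pi / 2)"
    "(\<lambda>n. weak_form (V n)) \<longlonglongrightarrow> weak_form v"
proof -
  have v_H1: "v \<in> H1 \<Omega>" using v by (simp add: H1_0_def)
  \<comment> \<open>\<open>Suc n\<close> keeps the scale positive from the first term on.\<close>
  define \<psi> where "\<psi> n s = real (Suc n) * arctan (s / real (Suc n))" for n s
  define \<psi>' where "\<psi>' n s = inverse (1 + (s / real (Suc n))\<^sup>2)" for n s
  define V where "V n x = \<psi> n (v x)" for n x
  have pos: "0 < real (Suc n)" for n by simp
  have deriv: "(\<psi> n has_real_derivative \<psi>' n s) (at s)" for n s
    unfolding \<psi>_def[abs_def] \<psi>'_def by (rule has_real_derivative_scaled_arctan[OF pos])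
  have nz: "1 + t\<^sup>2 \<noteq> 0" for t :: real by (metis add_pos_nonneg less_irrefl zero_le_power2 zero_less_one)
  have cont: "continuous_on UNIV (\<psi>' n)" for n
    unfolding \<psi>'_def[abs_def] using nz by (intro continuous_intros) auto
  have zero: "\<psi> n 0 = 0" for n by (simp add: \<psi>_def)
  have bound: "\<bar>\<psi>' n s\<bar> \<le> 1" for n s unfolding \<psi>'_def by (rule inverse_one_plus_square_bound)
  have \<psi>_le: "\<bar>\<psi> n s\<bar> \<le> \<bar>s\<bar>" for n s unfolding \<psi>_def by (rule scaled_arctan_bounds(1)[OF pos])
  have \<psi>_lim: "(\<lambda>n. \<psi> n s) \<longlonglongrightarrow> s" for s unfolding \<psi>_def by (rule scaled_arctan_tendsto)
  have \<psi>'_lim: "(\<lambda>n. \<psi>' n s) \<longlonglongrightarrow> 1" for s unfolding \<psi>'_def by (rule inverse_one_plus_square_tendsto)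
  have weak: "has_weak_grad \<Omega> (V n) (\<lambda>x. \<psi>' n (v x) *\<^sub>R weak_grad \<Omega> v x)" for n
    unfolding V_def[abs_def]
    by (rule H1_compose_approx[OF \<Omega> dense v_H1 deriv cont zero bound])
  have V_H1: "V n \<in> H1 \<Omega>" for n by (rule has_weak_grad_imp_H1[OF weak])
  have TV: "AE y in surface_on (frontier \<Omega>). T (V n) y = \<psi> n (T v y)" for n
    unfolding V_def[abs_def] by (rule trace_compose[OF \<Omega> dense T v_H1 deriv cont zero bound])
  have V_H1_0: "V n \<in> H1_0 \<Omega> D T" for n
  proof -
    have "AE y in surface_on D. T (V n) y = \<psi> n (T v y)"
      by (rule AE_restrict_space_mono[OF _ D(2) frontier_borel TV]) (use D in \<open>simp add: sets_surface_measure\<close>)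
    moreover have "AE y in surface_on D. T v y = 0" using v by (simp add: H1_0_def)
    ultimately have "AE y in surface_on D. T (V n) y = 0"
      by eventually_elim (simp add: zero)
    then show ?thesis using V_H1 by (simp add: H1_0_def)
  qed
  have V_bound: "\<bar>V n x\<bar> \<le> real (Suc n) * (pi / 2)" for n x
    unfolding V_def \<psi>_def by (rule scaled_arctan_bounds(2)[OF pos])
  let ?p = "\<lambda>x. a x *v weak_grad \<Omega> u x" and ?q = nonlinearity and ?b = "\<lambda>y. c y * T u y - g\<^sub>N y"
  note p_L2 = a_mult_L2[OF grad_u_L2]
  note v_L2 = H1_L2[OF v_H1]
  have bulk_meas: "(\<lambda>x. ?p x \<bullet> weak_grad \<Omega> w x + ?q x * w x) \<in> borel_measurable M" if "w \<in> H1 \<Omega>" for w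
    using L2_integrable_bilinear[OF bounded_bilinear_inner p_L2 H1_L2(2)[OF that]]
      L2_integrable_bilinear[OF bounded_bilinear_mult nonlinearity_L2 H1_L2(1)[OF that]]
    by (intro borel_measurable_add) auto
  have "(\<lambda>n. LINT x|M. ?p x \<bullet> weak_grad \<Omega> (V n) x + ?q x * V n x)
      \<longlonglongrightarrow> (LINT x|M. ?p x \<bullet> weak_grad \<Omega> v x + ?q x * v x)"
  proof (rule integral_dominated_convergence[where w="\<lambda>x. norm (?p x) * norm (weak_grad \<Omega> v x) + norm (?q x) * norm (v x)"])
    show "integrable M (\<lambda>x. norm (?p x) * norm (weak_grad \<Omega> v x) + norm (?q x) * norm (v x))"
      by (intro Bochner_Integration.integrable_add L2_integrable_norm_mult p_L2 nonlinearity_L2 v_L2)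
    \<comment> \<open>One null set for all \<open>n\<close>, since pointwise convergence involves
      the whole sequence at a fixed \<open>x\<close>.\<close>
    have "AE x in M. \<forall>n. weak_grad \<Omega> (V n) x = \<psi>' n (v x) *\<^sub>R weak_grad \<Omega> v x"
      unfolding AE_all_countable using weak_grad_AE_eq[OF \<Omega> weak] by blast
    then show "AE x in M. (\<lambda>n. ?p x \<bullet> weak_grad \<Omega> (V n) x + ?q x * V n x) \<longlonglongrightarrow> ?p x \<bullet> weak_grad \<Omega> v x + ?q x * v x"
    proof eventually_elim
      case (elim x)
      have "(\<lambda>n. ?p x \<bullet> (\<psi>' n (v x) *\<^sub>R weak_grad \<Omega> v x) + ?q x * \<psi> n (v x))
          \<longlonglongrightarrow> ?p x \<bullet> (1 *\<^sub>R weak_grad \<Omega> v x) + ?q x * v x"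
        by (intro tendsto_intros \<psi>_lim \<psi>'_lim)
      then show ?case using elim by (simp add: V_def)
    qed
    show "AE x in M. norm (?p x \<bullet> weak_grad \<Omega> (V n) x + ?q x * V n x)
        \<le> norm (?p x) * norm (weak_grad \<Omega> v x) + norm (?q x) * norm (v x)" for n
      using weak_grad_AE_eq[OF \<Omega> weak, of n]
    proof eventually_elim
      case (elim x)
      have "norm (?p x \<bullet> weak_grad \<Omega> (V n) x) \<le> norm (?p x) * norm (weak_grad \<Omega> (V n) x)"
        using Cauchy_Schwarz_ineq2 by simp
      also have "norm (weak_grad \<Omega> (V n) x) \<le> 1 * norm (weak_grad \<Omega> v x)"
        unfolding elim norm_scaleR by (intro mult_right_mono bound) auto
      finally have "norm (?p x \<bullet> weak_grad \<Omega> (V n) x) \<le> norm (?p x) * norm (weak_grad \<Omega> v x)"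
        by (simp add: mult_left_mono)
      moreover have "norm (?q x * V n x) \<le> norm (?q x) * norm (v x)"
        using \<psi>_le[of n "v x"] by (simp add: V_def abs_mult mult_left_mono)
      ultimately show ?case by (intro norm_triangle_le add_mono)
    qed
  qed (rule bulk_meas V_H1 v_H1)+
  moreover have "(\<lambda>n. LINT y|S. ?b y * T (V n) y) \<longlonglongrightarrow> (LINT y|S. ?b y * T v y)"
  proof (rule integral_dominated_convergence[where w="\<lambda>y. norm (?b y) * norm (T v y)"])
    have TVS: "AE y in S. T (V n) y = \<psi> n (T v y)" for n
      by (rule AE_restrict_space_mono[OF _ N(2) frontier_borel TV]) (use N in \<open>simp add: sets_surface_measure\<close>)
    show "integrable S (\<lambda>y. norm (?b y) * norm (T v y))"
      by (intro L2_integrable_norm_mult flux_L2 trace_L2 v_H1)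
    show "(\<lambda>y. ?b y * T v y) \<in> borel_measurable S" "(\<lambda>y. ?b y * T (V n) y) \<in> borel_measurable S" for n
      using L2_measurable[OF flux_L2] L2_measurable[OF trace_L2] v_H1 V_H1 by (auto intro: borel_measurable_times)
    have "AE y in S. \<forall>n. T (V n) y = \<psi> n (T v y)"
      unfolding AE_all_countable using TVS by blast
    then show "AE y in S. (\<lambda>n. ?b y * T (V n) y) \<longlonglongrightarrow> ?b y * T v y"
      by eventually_elim (auto intro!: tendsto_mult_left \<psi>_lim)
    show "AE y in S. norm (?b y * T (V n) y) \<le> norm (?b y) * norm (T v y)" for n
      using TVS[of n]
    proof eventually_elim
      case (elim y)
      then show ?case using \<psi>_le[of n "T v y"] by (simp add: abs_mult mult_left_mono)
    qed
  qed
  ultimately have "(\<lambda>n. weak_form (V n)) \<longlonglongrightarrow> weak_form v"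
    unfolding weak_form_def by (rule tendsto_add)
  with V_H1_0 V_bound that show thesis by blast
qed

theorem weak_solution_iff_critical_point:
  "weak_solution \<Omega> D N T a R \<tau>2 \<sigma>2 \<rho> c g\<^sub>N u \<longleftrightarrow>
    critical_point (energy \<Omega> N T a R \<tau>2 \<sigma>2 \<rho> c g\<^sub>N) (energy_domain \<Omega>) (H1_0 \<Omega> D T) (H1_norm \<Omega>) u"
proof
  let ?E = "energy \<Omega> N T a R \<tau>2 \<sigma>2 \<rho> c g\<^sub>N"
  have H1_0_H1: "v \<in> H1 \<Omega>" if "v \<in> H1_0 \<Omega> D T" for v using that by (simp add: H1_0_def)
  {
    assume "weak_solution \<Omega> D N T a R \<tau>2 \<sigma>2 \<rho> c g\<^sub>N u"
    then have W: "weak_form v = 0" if "v \<in> H1_0 \<Omega> D T" for v using that by (simp add: weak_solution_iff)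
    have "((\<lambda>t. ?E (\<lambda>x. u x + t * v x)) has_real_derivative 0) (at 0)"
      if v: "v \<in> H1_0 \<Omega> D T" and dom: "\<forall>\<^sub>F t in nhds 0. (\<lambda>x. u x + t * v x) \<in> energy_domain \<Omega>" for v
    proof -
      obtain B where "AE x in M. \<bar>v x\<bar> \<le> B" using u_line_in_domain_imp_bounded[OF dom] .
      from energy_has_real_derivative[OF H1_0_H1[OF v] this] show ?thesis using W[OF v] by simp
    qed
    \<comment> \<open>The zero functional is linear and bounded with constant 0, so only the
      derivative along admissible lines has content.\<close>
    then have "has_gateaux_derivative ?E (energy_domain \<Omega>) (H1_0 \<Omega> D T) (H1_norm \<Omega>) u (\<lambda>_. 0)"
      by (auto simp: has_gateaux_derivative_def intro!: exI[of _ 0])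
    then show "critical_point ?E (energy_domain \<Omega>) (H1_0 \<Omega> D T) (H1_norm \<Omega>) u"
      unfolding critical_point_def by (intro exI[of _ "\<lambda>_. 0"]) simp
  }
  assume "critical_point ?E (energy_domain \<Omega>) (H1_0 \<Omega> D T) (H1_norm \<Omega>) u"
  then obtain L where L: "has_gateaux_derivative ?E (energy_domain \<Omega>) (H1_0 \<Omega> D T) (H1_norm \<Omega>) u L"
      "\<And>v. v \<in> H1_0 \<Omega> D T \<Longrightarrow> L v = 0"
    unfolding critical_point_def by blast
  \<comment> \<open>A bounded direction stays in the energy domain, so uniqueness of derivatives
    identifies \<open>weak_form v\<close> with \<open>L v\<close>.\<close>
  have bounded_zero: "weak_form v = 0" if v: "v \<in> H1_0 \<Omega> D T" and vb: "\<And>x. \<bar>v x\<bar> \<le> B" for v B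
  proof -
    have B: "AE x in M. \<bar>v x\<bar> \<le> B" using vb by simp
    have "((\<lambda>t. ?E (\<lambda>x. u x + t * v x)) has_real_derivative L v) (at 0)"
      using L(1) v bounded_imp_u_line_in_domain[OF H1_0_H1[OF v] B] unfolding has_gateaux_derivative_def by blast
    with energy_has_real_derivative[OF H1_0_H1[OF v] B] have "weak_form v = L v"
      by (rule DERIV_unique)
    then show ?thesis using L(2)[OF v] by simp
  qed
  have "weak_form v = 0" if v: "v \<in> H1_0 \<Omega> D T" for v
  proof -
    obtain V where V: "\<And>n. V n \<in> H1_0 \<Omega> D T" "\<And>n x. \<bar>V n x\<bar> \<le> real (Suc n) * (pi / 2)"
      "(\<lambda>n. weak_form (V n)) \<longlonglongrightarrow> weak_form v"
      by (rule bounded_H1_0_approx[OF v]) (rule that)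
    then show ?thesis using bounded_zero[OF V(1) V(2)] by (simp add: LIMSEQ_const_iff)
  qed
  then show "weak_solution \<Omega> D N T a R \<tau>2 \<sigma>2 \<rho> c g\<^sub>N u" by (simp add: weak_solution_iff)
qed

end

theorem theorem2p1:
  fixes \<Omega> D N :: "(real^3) set"
    and T :: "(real^3 \<Rightarrow> real) \<Rightarrow> real^3 \<Rightarrow> real"
    and a :: "real^3 \<Rightarrow> real^3^3"
    and R \<tau>2 \<sigma>2 \<rho> c g\<^sub>N g\<^sub>D u :: "real^3 \<Rightarrow> real"
    and u_minus u_plus C\<^sub>1 C\<^sub>2 :: real
  assumes "open \<Omega>" and "smooth_dense_in_H1 \<Omega>" and "trace_operator \<Omega> T"
    and "frontier \<Omega> = D \<union> N" and "D \<inter> N = {}" and "D \<in> sets borel" and "N \<in> sets borel"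
    and "a \<in> borel_measurable (lebesgue_on \<Omega>)"
    and "\<exists>B. AE x in lebesgue_on \<Omega>. norm (a x) \<le> B"
    and "AE x in lebesgue_on \<Omega>. transpose (a x) = a x"
    and "c \<in> borel_measurable (surface_on N)"
    and "\<exists>B. AE y in surface_on N. \<bar>c y\<bar> \<le> B"
    and "g\<^sub>N \<in> L2 (surface_on N)"
    and "R \<in> borel_measurable (lebesgue_on \<Omega>)"
    and "0 < C\<^sub>1" and "0 < C\<^sub>2" and "\<And>x. x \<in> \<Omega> \<Longrightarrow> - C\<^sub>1 \<le> R x \<and> R x \<le> C\<^sub>2"
    and "\<tau>2 \<in> L2 (lebesgue_on \<Omega>)" and "\<sigma>2 \<in> L2 (lebesgue_on \<Omega>)" and "\<rho> \<in> L2 (lebesgue_on \<Omega>)"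
    and "\<And>x. x \<in> \<Omega> \<Longrightarrow> 0 \<le> \<tau>2 x \<and> 0 \<le> \<sigma>2 x \<and> 0 \<le> \<rho> x"
    and "0 < u_minus \<or> u_plus < 0"
    and "u \<in> H1_D \<Omega> D g\<^sub>D T \<inter> order_interval \<Omega> u_minus u_plus"
  shows "weak_solution \<Omega> D N T a R \<tau>2 \<sigma>2 \<rho> c g\<^sub>N u \<longleftrightarrow>
    critical_point (energy \<Omega> N T a R \<tau>2 \<sigma>2 \<rho> c g\<^sub>N) (energy_domain \<Omega>) (H1_0 \<Omega> D T) (H1_norm \<Omega>) u"
proof -
  obtain Ba where Ba: "AE x in lebesgue_on \<Omega>. norm (a x) \<le> Ba" using assms(9) by blast
  obtain Bc where Bc: "AE y in surface_on N. \<bar>c y\<bar> \<le> Bc" using assms(12) by blast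
  \<comment> \<open>Both constants are positive, so their sum dominates either one-sided
    bound.\<close>
  have "AE x in lebesgue_on \<Omega>. \<bar>R x\<bar> \<le> C\<^sub>1 + C\<^sub>2"
    using assms(15-17) by (intro AE_I2) fastforce
  then interpret hamiltonian_constraint \<Omega> D N T a R \<tau>2 \<sigma>2 \<rho> c g\<^sub>N u u_minus u_plus Ba Bc "C\<^sub>1 + C\<^sub>2"
    using assms Ba Bc by unfold_locales (auto simp: H1_D_def)
  show ?thesis by (rule weak_solution_iff_critical_point)
qed

end
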